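(* Let $d$ and $t$ be positive integers. Let $S$ be a $t$-thin finite set of compact convex objects in $\mathbb{R}^d$, let $G$ be the intersection graph of $S$, and let $\prec$ be a sizewise linear ordering of $S$. Then for each integer $k\ge 1$: \begin{itemize} \item[(a)] If $S$ consists of scaled and translated copies of the same centrally symmetric compact convex object, then $$\mathrm{wcol}_{\prec,k}(G)\le t\max(1,\lceil \log_2 k\rceil)(4k-1)^d\binom{k+t5^d+2}{t5^d+2}.$$ \item[(b)] If $S$ consists of $b$-ball-like objects for a real number $b\ge 1$, then $$\mathrm{wcol}_{\prec,k}(G)\le tb\max(1,\lceil \log_2 k\rceil)(4k)^d\binom{k+tb6^d+2}{tb6^d+2}.$$ \end{itemize} Moreover, there exists $k_0$ depending only on $d$ such that if $S$ consists of balls, then for every integer $k\ge k_0$, $$\mathrm{wcol}_{\prec,k}(G)\le t\max(1,\lceil \log_2 k\rceil)(4k-1)^d\binom{k+2t+2}{2t+2}.$$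
   Context: All graphs are finite, simple, undirected. The intersection graph of a finite set $S$ of objects in $\mathbb{R}^d$ is the graph with vertex set $S$ in which $u\neq v$ are adjacent iff $u\cap v\neq\emptyset$. For an integer $t\ge1$, $S$ is $t$-thin if every point of $\mathbb{R}^d$ lies in the interior of at most $t$ objects of $S$. A linear ordering $\prec$ of a finite set of compact objects is sizewise if $u\prec v$ implies $\mathrm{diam}(u)\ge\mathrm{diam}(v)$, where $\mathrm{diam}(v)$ is the maximum distance between two points of $v$. For $b\ge1$, an object $v$ is $b$-ball-like if it is a compact convex set with $\mathrm{vol}(v)\ge \mathrm{vol}(B(\mathrm{diam}(v)/2))/b$, where $B(a)$ is a ball in $\mathbb{R}^d$ of radius $a$. For a graph $G$, a linear ordering $\prec$ of $V(G)$ and an integer $k\ge0$, a vertex $u$ is weakly $k$-reachable from $v$ if $u\preceq v$ and there is a path in $G$ from $v$ to $u$ of length at most $k$ all of whose internal vertices are greater than $u$ (so $v$ is weakly $k$-reachable from itself); $\mathrm{wreach}_{G,\prec,k}(v)$ is the set of such $u$, and $\mathrm{wcol}_{\prec,k}(G)=\max_{v\in V(G)}|\mathrm{wreach}_{G,\prec,k}(v)|$.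
   Formalization: In (a) the common centrally symmetric object is assumed to have nonempty interior; otherwise the claim fails: n overlapping translates of a segment on one line in the plane are vacuously 1-thin, yet their intersection graph is complete on n vertices. *)

theory Defs
  imports "HOL-Analysis.Analysis"
begin

section \<open>Weak coloring numbers\<close>

text \<open>A finite simple undirected graph is a pair of its vertex set and its set of two-element
  edges. A linear ordering is given by its reflexive relation: \<open>(u, v) \<in> r\<close> means that \<open>u\<close>
  precedes or equals \<open>v\<close>.\<close>

type_synonym 'v graph = "'v set \<times> 'v set set"

definition is_path :: "'v graph \<Rightarrow> 'v \<Rightarrow> 'v \<Rightarrow> 'v list \<Rightarrow> bool" where
  "is_path G v u p \<longleftrightarrow> p \<noteq> [] \<and> hd p = v \<and> last p = u \<and> distinct p \<and> set p \<subseteq> fst G \<and>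
     successively (\<lambda>x y. {x, y} \<in> snd G) p"

text \<open>The length of a path is its number of edges, and the internal vertices of the path \<open>p\<close> are
  the elements of \<open>butlast (tl p)\<close>.\<close>

definition wreach :: "'v rel \<Rightarrow> nat \<Rightarrow> 'v graph \<Rightarrow> 'v \<Rightarrow> 'v set" where
  "wreach r k G v =
     {u \<in> fst G. (u, v) \<in> r \<and>
        (\<exists>p. is_path G v u p \<and> length p - 1 \<le> k \<and>
             (\<forall>w \<in> set (butlast (tl p)). (u, w) \<in> r \<and> u \<noteq> w))}"

definition wcol :: "'v rel \<Rightarrow> nat \<Rightarrow> 'v graph \<Rightarrow> nat" where
  "wcol r k G = (if fst G = {} then 0 else Max ((\<lambda>v. card (wreach r k G v)) ` fst G))"

section \<open>Intersection graphs\<close>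

definition intersection_graph :: "'a set set \<Rightarrow> 'a set graph" where
  "intersection_graph S = (S, {{u, v} | u v. u \<in> S \<and> v \<in> S \<and> u \<noteq> v \<and> u \<inter> v \<noteq> {}})"

definition thin :: "nat \<Rightarrow> 'a::topological_space set set \<Rightarrow> bool" where
  "thin t S \<longleftrightarrow> (\<forall>x. card {v \<in> S. x \<in> interior v} \<le> t)"

definition sizewise :: "'a::metric_space set set \<Rightarrow> 'a set rel \<Rightarrow> bool" where
  "sizewise S r \<longleftrightarrow> linear_order_on S r \<and>
     (\<forall>u \<in> S. \<forall>v \<in> S. (u, v) \<in> r \<and> u \<noteq> v \<longrightarrow> diameter v \<le> diameter u)"

section \<open>Classes of objects\<close>

definition centrally_symmetric :: "'a::real_vector set \<Rightarrow> bool" where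
  "centrally_symmetric K \<longleftrightarrow> (\<exists>z. \<forall>x \<in> K. 2 *\<^sub>R z - x \<in> K)"

definition scaled_translate :: "'a::real_vector set \<Rightarrow> 'a set \<Rightarrow> bool" where
  "scaled_translate K v \<longleftrightarrow> (\<exists>c > 0. \<exists>a. v = (\<lambda>x. a + c *\<^sub>R x) ` K)"

definition ball_like :: "real \<Rightarrow> 'a::euclidean_space set \<Rightarrow> bool" where
  "ball_like b v \<longleftrightarrow> compact v \<and> convex v \<and>
     measure lebesgue v \<ge> measure lebesgue (cball (0::'a) (diameter v / 2)) / b"

definition is_ball :: "'a::metric_space set \<Rightarrow> bool" where
  "is_ball v \<longleftrightarrow> (\<exists>x. \<exists>\<rho> > 0. v = cball x \<rho>)"

section \<open>Binomial coefficients with real arguments\<close>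

text \<open>The bound for ball-like objects contains a binomial coefficient both of whose arguments may
  be non-integral.\<close>

definition real_binomial :: "real \<Rightarrow> real \<Rightarrow> real" where
  "real_binomial x y = Gamma (x + 1) / (Gamma (y + 1) * Gamma (x - y + 1))"

lemma real_binomial_eq_gbinomial:
  assumes "x \<ge> 0"
  shows "real_binomial (real k + x) x = (real k + x) gchoose k"
proof -
  have "real k + x + 1 \<notin> \<int>\<^sub>\<le>\<^sub>0"
    using assms by (auto elim!: nonpos_Ints_cases)
  then have "(real k + x) gchoose k = Gamma (real k + x + 1) / (fact k * Gamma (x + 1))"
    by (simp add: gbinomial_Gamma)
  moreover have "Gamma (real k + 1) = fact k"
    using Gamma_fact[of k, where 'a = real] by (simp add: add.commute)
  ultimately show ?thesis
    by (simp add: real_binomial_def mult.commute)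
qed

lemma real_binomial_of_nat:
  "real_binomial (real (k + n)) (real n) = real ((k + n) choose n)"
proof -
  have "real_binomial (real k + real n) (real n) = real (k + n) gchoose k"
    by (simp add: real_binomial_eq_gbinomial)
  also have "\<dots> = real ((k + n) choose k)"
    by (simp only: binomial_gbinomial)
  also have "(k + n) choose k = (k + n) choose n"
    using binomial_symmetric[of k "k + n"] by simp
  finally show ?thesis by simp
qed

end

theory Submission
  imports Defs
begin

text \<open>Fix an object \<open>v\<close> and split the sizes of the other objects into levels
  \<open>[R\<^sub>j, R\<^sub>j\<^sub>+\<^sub>1)\<close> with ratio \<open>R\<^sub>j\<^sub>+\<^sub>1 / R\<^sub>j = 2\<^sup>q \<ge> k\<close>. A target \<open>u\<close> is reached by a path of \<open>k\<close> objects no larger than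
  \<open>u\<close>, so by volume each factor-two scale contains few targets, and it remains to bound the number of
  levels containing a target. Let \<open>g\<^sub>j(a)\<close> count the objects of size at least \<open>R\<^sub>j\<^sub>+\<^sub>1\<close> at distance
  exactly \<open>a\<close> from \<open>v\<close> through objects smaller than \<open>R\<^sub>j\<close>, plus one if \<open>a = a\<^sub>j\<close> is the least distance of an object of
  level \<open>j\<close>. Passing to level \<open>j + 1\<close> destroys the entry at \<open>a\<^sub>j\<close>, and whatever becomes reachable
  only through level \<open>j\<close> has distance greater than \<open>a\<^sub>j\<close>; so the vectors \<open>g\<^sub>j\<close> decrease
  lexicographically. Objects of size \<open>R\<^sub>j\<^sub>+\<^sub>1\<close> met within distance \<open>2k R\<^sub>j\<close> number at most some \<open>s\<close>, again
  by volume, hence the vectors have sum at most \<open>s + 1\<close> and there are at most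
  \<open>(k + s + 1) choose (s + 1)\<close> levels.

  For balls a ratio of order \<open>k\<^sup>3\<close> makes large balls look like half-spaces, whence
  \<open>s \<le> 2t(1 + O(1/k))\<close>. The levels now consist of about \<open>3 log k\<close> scales, but all of them matter only in
  levels with \<open>a\<^sub>j < k\<close>, of which there are only \<open>(k + s) choose (s + 1)\<close>.\<close>
section \<open>Lexicographic descents\<close>

text \<open>At each index of \<open>J\<close> the vector of entries 1 to k drops lexicographically,
  and at the other indices it drops coordinatewise. The vectors belonging to different elements of
  \<open>J\<close> are therefore distinct, and stars and bars counts the vectors with sum at most
  \<open>N\<close>.\<close>

lemma card_lexicographic_descents:
  fixes g :: "nat \<Rightarrow> nat \<Rightarrow> nat" and J :: "nat set"
  assumes sum: "\<And>j. (\<Sum>b=1..k. g j b) \<le> N"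
    and strict: "\<And>j. j \<in> J \<Longrightarrow>
      \<exists>b\<in>{1..k}. g (Suc j) b < g j b \<and> (\<forall>c\<in>{1..<b}. g (Suc j) c \<le> g j c)"
    and weak: "\<And>j b. j \<notin> J \<Longrightarrow> b \<in> {1..k} \<Longrightarrow> g (Suc j) b \<le> g j b"
  shows "finite J \<and> card J \<le> (k + N) choose N"
proof -
  \<comment> \<open>Coordinates before \<open>b\<close> may decrease instead of being equal. This
    still makes \<open>f\<close> lexicographically smaller than \<open>h\<close>, and it lets
    \<open>L\<close> compose with the coordinatewise drops outside \<open>J\<close>.\<close>
  define L where "L f h \<longleftrightarrow> (\<exists>b\<in>{1..k}. f b < h b \<and> (\<forall>c\<in>{1..<b}. f c \<le> h c))"
    for f h :: "nat \<Rightarrow> nat"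
  have L_trans: "L f h" if "L f g" "L g h" for f g h
  proof -
    obtain b where b: "b \<in> {1..k}" "f b < g b" "\<forall>c\<in>{1..<b}. f c \<le> g c"
      using \<open>L f g\<close> L_def by auto
    obtain b' where b': "b' \<in> {1..k}" "g b' < h b'" "\<forall>c\<in>{1..<b'}. g c \<le> h c"
      using \<open>L g h\<close> L_def by auto
    have "f (min b b') < h (min b b')"
    proof (cases b b' rule: linorder_cases)
      case less
      then have "g b \<le> h b" using b b' by auto
      then show ?thesis using less b by (simp add: min_def)
    next
      case equal
      then show ?thesis using b b' by simp
    next
      case greater
      then have "f b' \<le> g b'" using b b' by auto
      then show ?thesis using greater b' by (simp add: min_def)
    qed
    moreover have "f c \<le> h c" if "c \<in> {1..<min b b'}" for c
      using that b(3) b'(3) by (meson atLeastLessThan_iff le_trans min_less_iff_conj)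
    ultimately show ?thesis unfolding L_def using b(1) b'(1)
      by (intro bexI[of _ "min b b'"]) auto
  qed
  have L_weak: "L f h" if "\<forall>b\<in>{1..k}. f b \<le> g b" "L g h" for f g h
  proof -
    obtain b' where b': "b' \<in> {1..k}" "g b' < h b'" "\<forall>c\<in>{1..<b'}. g c \<le> h c"
      using \<open>L g h\<close> L_def by auto
    have "f c \<le> h c" if "c \<in> {1..<b'}" for c
      using that b' \<open>\<forall>b\<in>{1..k}. f b \<le> g b\<close>
      by (meson atLeastAtMost_iff atLeastLessThan_iff le_trans less_imp_le_nat)
    then show ?thesis unfolding L_def using b' that(1)
      by (intro bexI[of _ b']) (auto intro: le_less_trans)
  qed
  have L_less: "L (g (i + Suc n)) (g i)" if "i \<in> J" for i n
  proof (induction n)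
    case 0
    then show ?case using strict[OF that] by (simp add: L_def)
  next
    case (Suc n)
    show ?case
    proof (cases "i + Suc n \<in> J")
      case True
      then have "L (g (Suc (i + Suc n))) (g (i + Suc n))"
        using strict L_def by blast
      then show ?thesis using L_trans Suc by auto
    next
      case False
      then show ?thesis using L_weak[OF _ Suc] weak by auto
    qed
  qed
  \<comment> \<open>The prepended slack entry turns sum at most \<open>N\<close> into sum exactly
    \<open>N\<close>, over \<open>k + 1\<close> entries; the subtraction is exact by
    \<open>sum\<close>.\<close>
  define V where "V j = (N - (\<Sum>b=1..k. g j b)) # map (g j) [1..<Suc k]" for j
  have "inj_on V J"
  proof (rule linorder_inj_onI)
    fix i j assume "i < j" "i \<in> J" "j \<in> J"
    then have "L (g j) (g i)" using L_less[of i "j - i - 1"] by simp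
    then obtain b where b: "b \<in> {1..k}" "g j b < g i b" using L_def by blast
    then have "b \<in> set [1..<Suc k]" by auto
    then have "map (g i) [1..<Suc k] \<noteq> map (g j) [1..<Suc k]"
      using b(2) by (metis map_eq_conv nat_less_le)
    then show "V i \<noteq> V j" unfolding V_def by blast
  qed auto
  let ?T = "{l::nat list. length l = Suc k \<and> sum_list l = N}"
  have "V ` J \<subseteq> ?T"
  proof -
    have "sum_list (map (g j) [1..<Suc k]) = (\<Sum>b=1..k. g j b)" for j
      by (subst interv_sum_list_conv_sum_set_nat)
        (simp only: set_upt atLeastLessThanSuc_atLeastAtMost)
    then show ?thesis using sum by (auto simp: V_def simp del: upt_Suc)
  qed
  moreover have "?T \<subseteq> {l. set l \<subseteq> {..N} \<and> length l = Suc k}"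
    using member_le_sum_list by fastforce
  then have "finite ?T"
    by (rule finite_subset) (simp add: finite_lists_length_eq)
  moreover have "card ?T = (k + N) choose N"
    by (simp add: card_length_sum_list add.commute)
  ultimately show ?thesis
    using \<open>inj_on V J\<close> by (metis card_image card_mono finite_imageD finite_subset)
qed

section \<open>Walks and levels of sizes\<close>

text \<open>Only vertices from which a step leaves are constrained, so the endpoint may lie outside
  \<open>Q\<close>: this models a large object met through small ones. The start \<open>v\<close> is
  exempt from \<open>Q\<close>. Repetitions are allowed, so walks can be cut and extended
  freely.\<close>

inductive walk_to :: "('v \<Rightarrow> 'v \<Rightarrow> bool) \<Rightarrow> 'v \<Rightarrow> 'v set \<Rightarrow> nat \<Rightarrow> 'v \<Rightarrow> bool"
  for adj v Q where
  start: "walk_to adj v Q 0 v"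
| step: "walk_to adj v Q n y \<Longrightarrow> y = v \<or> y \<in> Q \<Longrightarrow> adj y x \<Longrightarrow> walk_to adj v Q (Suc n) x"

lemma walk_to_mono:
  assumes "walk_to adj v Q n x" "Q \<subseteq> Q'"
  shows "walk_to adj v Q' n x"
  using assms by induction (auto intro: walk_to.intros)

lemma walk_to_0_iff: "walk_to adj v Q 0 x \<longleftrightarrow> x = v"
  by (auto elim: walk_to.cases intro: walk_to.intros)

text \<open>Cut the walk at the first vertex, other than \<open>v\<close>, from which it steps on
  outside \<open>Q\<close>: the part up to this vertex is a walk through \<open>Q\<close>, since
  endpoints are unconstrained.\<close>

lemma walk_to_larger:
  assumes "walk_to adj v Q' n x"
  shows "walk_to adj v Q n x \<or> (\<exists>c<n. \<exists>y\<in>Q' - Q. y \<noteq> v \<and> walk_to adj v Q c y)"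
  using assms
proof induction
  case start
  then show ?case by (auto intro: walk_to.intros)
next
  case (step n y x)
  from step.IH show ?case
  proof
    assume y: "walk_to adj v Q n y"
    show ?thesis
    proof (cases "y = v \<or> y \<in> Q")
      case True
      then show ?thesis using y step by (auto intro: walk_to.intros)
    next
      case False
      then show ?thesis using y step by auto
    qed
  qed (use less_Suc_eq in blast)
qed

lemma walk_to_in:
  assumes "walk_to adj v Q n x" "v \<in> S" "\<And>x y. adj x y \<Longrightarrow> y \<in> S"
  shows "x \<in> S"
  using assms by cases auto

lemma walk_to_of_path:
  assumes "p \<noteq> []" "hd p = v" "successively adj p" "set (butlast (tl p)) \<subseteq> Q"
  shows "walk_to adj v Q (length p - 1) (last p)"
  using assms
proof (induction p rule: rev_induct)
  case (snoc x p)
  show ?case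
  proof (cases "p = []")
    case True
    then show ?thesis using snoc by (auto intro: walk_to.intros)
  next
    case False
    have "set (butlast (tl p)) \<subseteq> set (tl p)" by (meson in_set_butlastD subsetI)
    then have "walk_to adj v Q (length p - 1) (last p)"
      using snoc False by (auto simp: successively_append_iff)
    moreover have "last p = v \<or> last p \<in> Q"
    proof (cases p)
      case (Cons w q)
      then show ?thesis using snoc.prems by (cases "q = []") (auto dest: subsetD[OF _ last_in_set])
    qed (use False in simp)
    moreover have "adj (last p) x" using snoc False by (auto simp: successively_append_iff)
    ultimately show ?thesis using walk_to.step False by (metis Suc_pred diff_Suc_1 last_snoc length_append_singleton length_greater_0_conv)
  qed
qed simp

text \<open>\<open>J\<close> is the set of levels that contain an object met within \<open>k\<close>
  steps through smaller levels. The vectors \<open>g j\<close> have sum at most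
  \<open>s + 1\<close>: at most \<open>s\<close> from the objects beyond level \<open>j\<close>, by
  \<open>reach\<close>, and one from the marker of level \<open>j\<close>. Every level in
  \<open>J\<close> forces a lexicographic descent.\<close>

lemma card_occupied_levels:
  fixes rad :: "'v \<Rightarrow> real" and R :: "nat \<Rightarrow> real"
  assumes "finite S" "v \<in> S" and adj: "\<And>x y. adj x y \<Longrightarrow> y \<in> S" and "mono R"
    and reach: "\<And>j. card {x\<in>S. x \<noteq> v \<and> R (Suc j) \<le> rad x \<and>
        (\<exists>n\<le>k. walk_to adj v {y. rad y < R j} n x)} \<le> s"
    and J: "J = {j. \<exists>x\<in>S. x \<noteq> v \<and> R j \<le> rad x \<and> rad x < R (Suc j) \<and>
        (\<exists>n\<le>k. walk_to adj v {y. rad y < R j} n x)}"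
  shows "finite J \<and> card J \<le> (k + (s + 1)) choose (s + 1)"
proof -
  define W where "W j = walk_to adj v {y. rad y < R j}" for j
  define exact where "exact j b x \<longleftrightarrow> W j b x \<and> (\<forall>c<b. \<not> W j c x)" for j b x
  define A where "A j = {x\<in>S. x \<noteq> v \<and> R j \<le> rad x}" for j
  define C where "C j = {x\<in>S. x \<noteq> v \<and> R j \<le> rad x \<and> rad x < R (Suc j)}" for j
  \<comment> \<open>The marker: \<open>first j b\<close> holds for at most one \<open>b\<close>, the
    least number of steps in which an object of level \<open>j\<close> is met.\<close>
  define first where "first j b \<longleftrightarrow> (\<exists>x\<in>C j. W j b x) \<and> (\<forall>c<b. \<forall>x\<in>C j. \<not> W j c x)" for j b
  define g where "g j b = card {x\<in>A (Suc j). exact j b x} + of_bool (first j b)" for j b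
  have fin: "finite (A j)" "finite (C j)" for j using \<open>finite S\<close> by (auto simp: A_def C_def)
  have Rle: "R j \<le> R (Suc j)" for j using \<open>mono R\<close> by (simp add: mono_iff_le_Suc)
  have CA: "C j \<subseteq> A j" "C j \<inter> A (Suc j) = {}" "A (Suc j) \<subseteq> A j" for j
    using Rle[of j] by (auto simp: A_def C_def)
  have W_mono: "W (Suc j) b x" if "W j b x" for j b x
    using that unfolding W_def by (rule walk_to_mono) (use Rle[of j] in auto)
  have in_S: "x \<in> S" if "W j b x" for j b x
    using walk_to_in[OF that[unfolded W_def] \<open>v \<in> S\<close> adj] .
  \<comment> \<open>Whatever needs level \<open>j\<close> on its walk lies strictly beyond the first
    object of that level, so admitting level \<open>j\<close> changes no distances up to that
    encounter.\<close>
  have W_back: "W j b x \<or> (\<exists>c<b. \<exists>y\<in>C j. W j c y)" if "W (Suc j) b x" for j b x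
  proof (rule disjCI)
    assume "\<not> (\<exists>c<b. \<exists>y\<in>C j. W j c y)"
    moreover have "y \<in> C j"
      if "y \<in> {y. rad y < R (Suc j)} - {y. rad y < R j}" "y \<noteq> v" "W j c y" for y c
      using that in_S by (auto simp: C_def not_less)
    ultimately show "W j b x"
      using walk_to_larger[OF \<open>W (Suc j) b x\<close>[unfolded W_def], of "{y. rad y < R j}"]
      unfolding W_def by blast
  qed
  have exact_back: "exact j b x" if "exact (Suc j) b x" "\<forall>c<b. \<forall>y\<in>C j. \<not> W j c y" for j b x
    using that W_back W_mono unfolding exact_def by blast
  have exact_ex: "\<exists>m\<le>n. exact j m x" if "W j n x" for j n x
    using that unfolding exact_def
    by (intro exI[of _ "LEAST m. W j m x"]) (auto intro: LeastI Least_le dest: not_less_Least)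
  have exact_unique: "b = c" if "exact j b x" "exact j c x" for j b c x
    using that unfolding exact_def by (metis linorder_neqE_nat)
  \<comment> \<open>Up to and including the first encounter with level \<open>j\<close> no entry
    grows, and at the encounter itself the loss of the marker makes the drop strict.\<close>
  have drop: "g (Suc j) b + of_bool (first j b) \<le> g j b" if "\<forall>c<b. \<forall>y\<in>C j. \<not> W j c y" for j b
  proof -
    have 1: "{x\<in>A (Suc (Suc j)). exact (Suc j) b x} \<subseteq> {x\<in>A (Suc j). exact j b x}"
      using CA exact_back that by blast
    have "g (Suc j) b \<le> card {x\<in>A (Suc j). exact j b x}"
    proof (cases "first (Suc j) b")
      case True
      \<comment> \<open>A new marker for level \<open>j + 1\<close> is paid for by an object
        \<open>x\<close> of that level: it is counted at stage \<open>j\<close> but belongs to the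
        level itself at stage \<open>j + 1\<close>, so the inclusion is proper.\<close>
      then obtain x where x: "x \<in> C (Suc j)" "exact (Suc j) b x"
        unfolding first_def exact_def by blast
      then have "x \<in> A (Suc j)" "exact j b x" "x \<notin> A (Suc (Suc j))"
        using CA exact_back that by blast+
      then have "{x\<in>A (Suc (Suc j)). exact (Suc j) b x} \<subset> {x\<in>A (Suc j). exact j b x}"
        using 1 by blast
      then have "card {x\<in>A (Suc (Suc j)). exact (Suc j) b x} < card {x\<in>A (Suc j). exact j b x}"
        using fin by (intro psubset_card_mono) auto
      then show ?thesis using True by (simp add: g_def)
    next
      case False
      then show ?thesis using 1 fin by (auto simp: g_def intro!: card_mono)
    qed
    then show ?thesis by (simp add: g_def)
  qed
  have W0: "\<not> W j 0 x" if "x \<noteq> v" for j x using that by (simp add: W_def walk_to_0_iff)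
  show ?thesis
  proof (rule card_lexicographic_descents[of g])
    fix j
    have "(\<Sum>b=1..k. card {x\<in>A (Suc j). exact j b x}) =
        card (\<Union>b\<in>{1..k}. {x\<in>A (Suc j). exact j b x})"
      using fin exact_unique by (subst card_UN_disjoint) auto
    also have "\<dots> \<le> card {x\<in>S. x \<noteq> v \<and> R (Suc j) \<le> rad x \<and>
        (\<exists>n\<le>k. walk_to adj v {y. rad y < R j} n x)}"
      using \<open>finite S\<close> by (intro card_mono) (auto simp: A_def exact_def W_def)
    finally have 1: "(\<Sum>b=1..k. card {x\<in>A (Suc j). exact j b x}) \<le> s" using reach[of j] by simp
    have "(\<Sum>b=1..k. of_bool (first j b)) = card {b\<in>{1..k}. first j b}"
      by (simp add: sum.If_cases of_bool_def Int_def)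
    also have "\<dots> \<le> 1"
    proof -
      have "b = c" if "first j b" "first j c" for b c
        using that unfolding first_def by (metis linorder_neqE_nat)
      then show ?thesis by (auto simp: card_le_Suc0_iff_eq)
    qed
    finally show "(\<Sum>b=1..k. g j b) \<le> s + 1" using 1 by (simp add: g_def sum.distrib)
  next
    fix j assume "j \<in> J"
    then obtain x n where x: "x \<in> C j" "n \<le> k" "W j n x" by (auto simp: J C_def W_def)
    define b where "b = (LEAST b. \<exists>x\<in>C j. W j b x)"
    have "first j b" unfolding first_def b_def
      using x LeastI_ex[of "\<lambda>b. \<exists>x\<in>C j. W j b x"] not_less_Least[of _ "\<lambda>b. \<exists>x\<in>C j. W j b x"]
      by blast
    moreover have "b \<le> n" unfolding b_def using x by (auto intro!: Least_le)
    moreover have "b \<noteq> 0" using W0 \<open>first j b\<close> by (auto simp: first_def C_def intro!: gr0I)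
    ultimately have "b \<in> {1..k}" "g (Suc j) b < g j b"
      using x drop[of b j] by (auto simp: first_def)
    moreover have "g (Suc j) c \<le> g j c" if "c \<in> {1..<b}" for c
      using drop[of c j] that \<open>first j b\<close> by (auto simp: first_def)
    ultimately show "\<exists>b\<in>{1..k}. g (Suc j) b < g j b \<and> (\<forall>c\<in>{1..<b}. g (Suc j) c \<le> g j c)"
      by blast
  next
    fix j b assume "j \<notin> J" "b \<in> {1..k}"
    then have "\<forall>c<b. \<forall>y\<in>C j. \<not> W j c y" by (fastforce simp: J C_def W_def)
    then show "g (Suc j) b \<le> g j b" using drop[of b j] by simp
  qed
qed

section \<open>Counting targets level by level\<close>

lemma geometric_interval_cover:
  fixes c x R :: real
  assumes "R \<le> x" "x < R * c ^ q"
  shows "\<exists>i<q. R * c ^ i \<le> x \<and> x < R * c ^ Suc i"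
  using assms(2)
proof (induction q)
  case 0
  then show ?case using assms(1) by simp
next
  case (Suc q)
  then show ?case
    by (cases "x < R * c ^ q") (auto simp: not_less intro: less_SucI)
qed

text \<open>A scale is an interval \<open>[R, 2R)\<close> of radii and a level consists of \<open>q\<close> consecutive
  scales. In a level containing a vertex reached from \<open>v\<close> in fewer than \<open>k\<close> steps through smaller
  levels, all \<open>q\<close> scales may contribute; in any other level the targets are themselves reached
  through smaller levels.\<close>

lemma card_targets:
  fixes rad :: "'v \<Rightarrow> real" and M R0 :: real
  assumes "finite S" "v \<in> S" and adj: "\<And>x y. adj x y \<Longrightarrow> y \<in> S" and "0 < R0" "q \<ge> 1"
    and U: "U \<subseteq> {u\<in>S. u \<noteq> v \<and> (\<exists>n\<le>k. walk_to adj v {y. rad y \<le> rad u} n u)}"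
    and R0: "\<And>u. u \<in> U \<Longrightarrow> R0 \<le> rad u"
    and scale: "\<And>R::real. R0 \<le> R \<Longrightarrow> card {u\<in>U. R \<le> rad u \<and> rad u < 2 * R} \<le> M"
    and far: "\<And>R::real. R0 \<le> R \<Longrightarrow> card {x\<in>S. x \<noteq> v \<and> 2 ^ q * R \<le> rad x \<and>
        (\<exists>n\<le>k. walk_to adj v {y. rad y < R} n x)} \<le> s"
  shows card_targets_crude: "card U \<le> M * q * ((k + (s + 1)) choose (s + 1))"
    and card_targets_refined:
      "(\<And>R::real. R0 \<le> R \<Longrightarrow> card {x\<in>S. x \<noteq> v \<and> R \<le> rad x \<and>
          (\<exists>n\<le>k. walk_to adj v {y. rad y < R} n x)} \<le> M) \<Longrightarrow>
        card U \<le> M * (((k + (s + 1)) choose (s + 1)) + q * ((k - 1 + (s + 1)) choose (s + 1)))"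
proof -
  define R where "R j = R0 * (2 ^ q) ^ j" for j
  define J where "J k' = {j. \<exists>x\<in>S. x \<noteq> v \<and> R j \<le> rad x \<and> rad x < R (Suc j) \<and>
      (\<exists>n\<le>k'. walk_to adj v {y. rad y < R j} n x)}" for k'
  define T where "T j = {u\<in>U. R j \<le> rad u \<and> rad u < R (Suc j)}" for j
  have c: "1 < (2::real) ^ q" using \<open>q \<ge> 1\<close> by (intro one_less_power) auto
  have R_Suc: "R (Suc j) = 2 ^ q * R j" for j by (simp add: R_def)
  have R_ge: "R0 \<le> R j" for j using \<open>0 < R0\<close> by (simp add: R_def)
  have "mono R" using \<open>0 < R0\<close>
    by (auto simp: R_def mono_def intro!: power_increasing)
  have "finite U" using U \<open>finite S\<close> by (auto intro: finite_subset)
  have "M \<ge> 0" using scale[of R0] by (meson of_nat_0_le_iff order_refl order_trans)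
  have cardJ: "finite (J k') \<and> card (J k') \<le> (k' + (s + 1)) choose (s + 1)" if "k' \<le> k" for k'
  proof (rule card_occupied_levels[OF \<open>finite S\<close> \<open>v \<in> S\<close> adj \<open>mono R\<close> _ J_def])
    fix j
    have "card {x \<in> S. x \<noteq> v \<and> R (Suc j) \<le> rad x \<and>
          (\<exists>n\<le>k'. walk_to adj v {y. rad y < R j} n x)} \<le>
        card {x\<in>S. x \<noteq> v \<and> 2 ^ q * R j \<le> rad x \<and> (\<exists>n\<le>k. walk_to adj v {y. rad y < R j} n x)}"
      using \<open>k' \<le> k\<close> \<open>finite S\<close> by (intro card_mono) (auto simp: R_Suc intro: order_trans)
    then show "card {x \<in> S. x \<noteq> v \<and> R (Suc j) \<le> rad x \<and>
          (\<exists>n\<le>k'. walk_to adj v {y. rad y < R j} n x)} \<le> s"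
      using far[OF R_ge, of j] by simp
  qed
  have cardT: "card (T j) \<le> M * q" for j
  proof -
    define A where "A i = {u\<in>U. R j * 2 ^ i \<le> rad u \<and> rad u < 2 * (R j * 2 ^ i)}" for i
    have "T j \<subseteq> (\<Union>i<q. A i)"
    proof
      fix u assume "u \<in> T j"
      then have u: "u \<in> U" "R j \<le> rad u" "rad u < R j * 2 ^ q"
        by (auto simp: T_def R_Suc mult.commute)
      then show "u \<in> (\<Union>i<q. A i)"
        using geometric_interval_cover[OF u(2,3)] by (auto simp: A_def mult_ac)
    qed
    then have "card (T j) \<le> card (\<Union>i<q. A i)"
      using \<open>finite U\<close> by (intro card_mono) (auto simp: A_def)
    also have "\<dots> \<le> (\<Sum>i<q. card (A i))" by (intro card_UN_le) auto
    finally have "real (card (T j)) \<le> (\<Sum>i<q. real (card (A i)))"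
      by (metis of_nat_le_iff of_nat_sum)
    also have "\<dots> \<le> (\<Sum>i<q. M)"
    proof (intro sum_mono)
      fix i
      have "R j * 1 \<le> R j * 2 ^ i"
        using R_ge[of j] \<open>0 < R0\<close> by (intro mult_left_mono) auto
      then have "R0 \<le> R j * 2 ^ i" using R_ge[of j] by simp
      then show "card (A i) \<le> M" unfolding A_def by (rule scale)
    qed
    finally show ?thesis by (simp add: mult.commute)
  qed
  have in_level: "\<exists>j. u \<in> T j" if "u \<in> U" for u
  proof -
    obtain m where "rad u / R0 < (2 ^ q) ^ m" using real_arch_pow[OF c] by blast
    then have "rad u < R0 * (2 ^ q) ^ m" using \<open>0 < R0\<close> by (simp add: field_simps)
    then show ?thesis
      using geometric_interval_cover[OF R0[OF that]] that unfolding T_def R_def by blast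
  qed
  \<comment> \<open>Cut the walk to \<open>u\<close> at its first object of size at least
    \<open>R j\<close>. Objects on the walk are no larger than \<open>u\<close>, so this object lies
    in level \<open>j\<close> and not above it.\<close>
  have walk: "walk_to adj v {y. rad y < R j} n u \<or>
      (\<exists>c<n. \<exists>y\<in>S. y \<noteq> v \<and> R j \<le> rad y \<and> rad y < R (Suc j) \<and> walk_to adj v {y. rad y < R j} c y)"
    if "u \<in> T j" "walk_to adj v {y. rad y \<le> rad u} n u" for u j n
  proof -
    from walk_to_larger[OF that(2), of "{y. rad y < R j}"] show ?thesis
    proof (elim disjE exE conjE bexE)
      fix c y assume y: "c < n" "y \<in> {y. rad y \<le> rad u} - {y. rad y < R j}" "y \<noteq> v"
        "walk_to adj v {y. rad y < R j} c y"
      have "y \<in> S" using y(4) \<open>v \<in> S\<close> adj by (rule walk_to_in)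
      then show ?thesis using y that(1) unfolding T_def by force
    qed simp
  qed
  have T_in_J: "j \<in> J k" if u: "u \<in> T j" for u j
  proof -
    obtain n where n: "n \<le> k" "walk_to adj v {y. rad y \<le> rad u} n u"
      using u U by (auto simp: T_def)
    from walk[OF u n(2)] show ?thesis
    proof
      assume "walk_to adj v {y. rad y < R j} n u"
      then show ?thesis using u n(1) U by (auto simp: J_def T_def)
    next
      assume "\<exists>c<n. \<exists>y\<in>S. y \<noteq> v \<and> R j \<le> rad y \<and> rad y < R (Suc j) \<and>
          walk_to adj v {y. rad y < R j} c y"
      then show ?thesis using n(1) unfolding J_def mem_Collect_eq by (meson less_imp_le less_le_trans)
    qed
  qed
  have "U \<subseteq> (\<Union>j\<in>J k. T j)" using in_level T_in_J by blast
  moreover have "finite (\<Union>j\<in>J k. T j)" using cardJ[of k] \<open>finite U\<close> by (auto simp: T_def)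
  ultimately have "card U \<le> card (\<Union>j\<in>J k. T j)" by (rule card_mono[rotated])
  also have "\<dots> \<le> (\<Sum>j\<in>J k. card (T j))" using cardJ[of k] by (intro card_UN_le) auto
  finally have U_le: "real (card U) \<le> (\<Sum>j\<in>J k. real (card (T j)))"
    by (metis of_nat_le_iff of_nat_sum)
  show "card U \<le> M * q * ((k + (s + 1)) choose (s + 1))"
  proof -
    have "(\<Sum>j\<in>J k. real (card (T j))) \<le> (\<Sum>j\<in>J k. M * q)"
      using cardT by (intro sum_mono)
    also have "\<dots> = M * q * card (J k)" by simp
    also have "\<dots> \<le> M * q * ((k + (s + 1)) choose (s + 1))"
      using cardJ[of k] \<open>M \<ge> 0\<close> by (intro mult_left_mono) auto
    finally show ?thesis using U_le by linarith
  qed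
  assume short: "\<And>R::real. R0 \<le> R \<Longrightarrow> card {x\<in>S. x \<noteq> v \<and> R \<le> rad x \<and>
      (\<exists>n\<le>k. walk_to adj v {y. rad y < R} n x)} \<le> M"
  \<comment> \<open>Outside \<open>J (k - 1)\<close> the first alternative of \<open>walk\<close>
    always holds, so \<open>short\<close> bounds the whole level at once, without splitting it into
    \<open>q\<close> scales.\<close>
  have cardT': "card (T j) \<le> M + (if j \<in> J (k - 1) then M * q else 0)" for j
  proof (cases "j \<in> J (k - 1)")
    case True
    then show ?thesis using cardT[of j] \<open>M \<ge> 0\<close> by simp
  next
    case False
    have "walk_to adj v {y. rad y < R j} n u"
      if "u \<in> T j" "n \<le> k" "walk_to adj v {y. rad y \<le> rad u} n u" for u n
    proof -
      have "\<not> (\<exists>c<n. \<exists>y\<in>S. y \<noteq> v \<and> R j \<le> rad y \<and> rad y < R (Suc j) \<and>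
          walk_to adj v {y. rad y < R j} c y)"
      proof
        assume "\<exists>c<n. \<exists>y\<in>S. y \<noteq> v \<and> R j \<le> rad y \<and> rad y < R (Suc j) \<and>
          walk_to adj v {y. rad y < R j} c y"
        then obtain c y where "c < n" "y \<in> S" "y \<noteq> v" "R j \<le> rad y" "rad y < R (Suc j)"
          "walk_to adj v {y. rad y < R j} c y" by blast
        moreover have "c \<le> k - 1" using \<open>c < n\<close> \<open>n \<le> k\<close> by linarith
        ultimately show False using False unfolding J_def by blast
      qed
      then show ?thesis using walk[OF that(1,3)] by blast
    qed
    then have "T j \<subseteq> {x\<in>S. x \<noteq> v \<and> R j \<le> rad x \<and> (\<exists>n\<le>k. walk_to adj v {y. rad y < R j} n x)}"
      using U unfolding T_def by blast
    then have "card (T j) \<le>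
        card {x\<in>S. x \<noteq> v \<and> R j \<le> rad x \<and> (\<exists>n\<le>k. walk_to adj v {y. rad y < R j} n x)}"
      using \<open>finite S\<close> by (intro card_mono) auto
    then have "real (card (T j)) \<le> M" using short[OF R_ge[of j]] by linarith
    then show ?thesis using False by simp
  qed
  have "(\<Sum>j\<in>J k. real (card (T j))) \<le> (\<Sum>j\<in>J k. M + (if j \<in> J (k - 1) then M * q else 0))"
    using cardT' by (intro sum_mono)
  also have "\<dots> = M * card (J k) + M * q * card (J k \<inter> J (k - 1))"
    using cardJ[of k] by (simp add: sum.distrib sum.inter_restrict[symmetric])
  also have "\<dots> \<le> M * card (J k) + M * q * card (J (k - 1))"
    using cardJ[of "k - 1"] \<open>M \<ge> 0\<close>
    by (intro add_left_mono mult_left_mono of_nat_mono card_mono) auto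
  also have "\<dots> \<le> M * ((k + (s + 1)) choose (s + 1)) + M * q * ((k - 1 + (s + 1)) choose (s + 1))"
    using cardJ[of k] cardJ[of "k - 1"] \<open>M \<ge> 0\<close>
    by (intro add_mono mult_left_mono of_nat_mono) auto
  finally show "card U \<le>
      M * (((k + (s + 1)) choose (s + 1)) + q * ((k - 1 + (s + 1)) choose (s + 1)))"
    using U_le by (simp add: algebra_simps)
qed

section \<open>Volume arguments\<close>

text \<open>The sum of the indicators is at most \<open>t\<close> times the indicator of
  \<open>\<Omega>\<close>; integrate. The multiplicity of a point is the quantity that
  \<open>thin\<close> controls.\<close>

lemma sum_measure_le_multiplicity:
  fixes A :: "'i \<Rightarrow> 'a::euclidean_space set"
  assumes "finite I" and A: "\<And>i. i \<in> I \<Longrightarrow> A i \<in> lmeasurable" "\<And>i. i \<in> I \<Longrightarrow> A i \<subseteq> \<Omega>"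
    and "\<Omega> \<in> lmeasurable" and mult: "\<And>x. card {i\<in>I. x \<in> A i} \<le> t"
  shows "(\<Sum>i\<in>I. measure lebesgue (A i)) \<le> t * measure lebesgue \<Omega>"
proof -
  have int: "integrable lebesgue (indicat_real B)" if "B \<in> lmeasurable" for B :: "'a set"
    using that lmeasurable_iff_integrable by blast
  have "(\<Sum>i\<in>I. measure lebesgue (A i)) = (\<Sum>i\<in>I. integral\<^sup>L lebesgue (indicat_real (A i)))"
    by simp
  also have "\<dots> = (\<integral>x. (\<Sum>i\<in>I. indicat_real (A i) x) \<partial>lebesgue)"
    using A(1) int by (subst Bochner_Integration.integral_sum) auto
  also have "\<dots> \<le> (\<integral>x. t * indicat_real \<Omega> x \<partial>lebesgue)"
  proof (rule integral_mono)
    fix x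
    have "(\<Sum>i\<in>I. indicat_real (A i) x) = card {i\<in>I. x \<in> A i}"
      using \<open>finite I\<close> by (simp add: indicator_def sum.If_cases Int_def)
    moreover have "{i\<in>I. x \<in> A i} = {}" if "x \<notin> \<Omega>" using A(2) that by blast
    ultimately show "(\<Sum>i\<in>I. indicat_real (A i) x) \<le> t * indicat_real \<Omega> x"
      using mult[of x] by (cases "x \<in> \<Omega>") auto
  qed (use A(1) int \<open>\<Omega> \<in> lmeasurable\<close> in auto)
  also have "\<dots> = t * measure lebesgue \<Omega>" by simp
  finally show ?thesis .
qed

text \<open>The frontier of a convex set is null. This links thinness, which speaks of interiors,
  with the volumes of the objects.\<close>

lemma measure_interior_convex:
  fixes A :: "'a::euclidean_space set"
  assumes "convex A" "bounded A"
  shows "measure lebesgue (interior A) = measure lebesgue A"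
proof -
  have "A - interior A \<subseteq> frontier A" by (auto simp: frontier_def closure_def)
  then have "negligible (A - interior A)"
    using negligible_convex_frontier[OF \<open>convex A\<close>] negligible_subset by blast
  then have "negligible (sym_diff A (interior A))"
    using interior_subset[of A] by (simp add: Diff_eq_empty_iff[THEN iffD2])
  then show ?thesis
    using measure_negligible_symdiff measurable_convex[OF assms] by metis
qed

section \<open>Dilates of a symmetric convex body as balls of a norm\<close>

locale symmetric_body =
  fixes K :: "'a::euclidean_space set"
  assumes compact: "compact K" and convex: "convex K" and measure_pos: "0 < measure lebesgue K"
    and minus_mem: "x \<in> K \<Longrightarrow> - x \<in> K"
begin

text \<open>For nonnegative \<open>\<rho>\<close> this is the closed ball of radius
  \<open>\<rho>\<close> around 0 in the norm with unit ball \<open>K\<close>, so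
  \<open>x - y \<in> D \<rho>\<close> plays the role of a distance bound.\<close>

definition D :: "real \<Rightarrow> 'a set" where "D \<rho> = (\<lambda>x. \<rho> *\<^sub>R x) ` K"

lemma zero_mem: "0 \<in> K"
proof -
  have "K \<noteq> {}" using measure_pos by auto
  then obtain x where "x \<in> K" by blast
  then have "(1/2) *\<^sub>R x + (1/2) *\<^sub>R (- x) \<in> K" using minus_mem convex by (intro convexD) auto
  then show ?thesis by simp
qed

text \<open>The triangle inequality of that norm: convexity of \<open>K\<close> with weights
  proportional to \<open>\<rho>\<close> and \<open>\<sigma>\<close>.\<close>

lemma D_add:
  assumes "x \<in> D \<rho>" "y \<in> D \<sigma>" "0 \<le> \<rho>" "0 \<le> \<sigma>"
  shows "x + y \<in> D (\<rho> + \<sigma>)"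
proof -
  obtain a b where ab: "a \<in> K" "b \<in> K" "x = \<rho> *\<^sub>R a" "y = \<sigma> *\<^sub>R b"
    using assms by (auto simp: D_def)
  show ?thesis
  proof (cases "\<rho> + \<sigma> = 0")
    case True
    then have "\<rho> = 0" "\<sigma> = 0" using assms by linarith+
    then show ?thesis using ab by (auto simp: D_def)
  next
    case False
    have "(\<rho> / (\<rho> + \<sigma>)) *\<^sub>R a + (\<sigma> / (\<rho> + \<sigma>)) *\<^sub>R b \<in> K"
      using ab assms False convex by (intro convexD) (auto simp: add_divide_distrib[symmetric])
    then have "(\<rho> + \<sigma>) *\<^sub>R ((\<rho> / (\<rho> + \<sigma>)) *\<^sub>R a + (\<sigma> / (\<rho> + \<sigma>)) *\<^sub>R b) \<in> D (\<rho> + \<sigma>)"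
      by (auto simp: D_def)
    then show ?thesis using False ab by (simp add: scaleR_right_distrib)
  qed
qed

lemma zero_mem_D: "0 \<in> D \<rho>"
  using zero_mem by (force simp: D_def)

lemma D_mono: "x \<in> D \<rho> \<Longrightarrow> 0 \<le> \<rho> \<Longrightarrow> \<rho> \<le> \<sigma> \<Longrightarrow> x \<in> D \<sigma>"
  using D_add[of x \<rho> 0 "\<sigma> - \<rho>"] zero_mem_D by simp

lemma measure_D_translate:
  assumes "0 \<le> \<rho>"
  shows "measure lebesgue ((+) z ` D \<rho>) = \<rho> ^ DIM('a) * measure lebesgue K"
proof -
  have "(+) z ` D \<rho> = (\<lambda>x. z + \<rho> *\<^sub>R x) ` K" by (auto simp: D_def)
  then show ?thesis
    using assms measure_lebesgue_affine[of \<rho> z K] by (simp add: add.commute)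
qed

lemma lmeasurable_D_translate: "(+) z ` D \<rho> \<in> lmeasurable"
  unfolding D_def by (intro lmeasurable_compact compact_translation compact_scaling compact)

lemma scaleR_D: "x \<in> D \<sigma> \<Longrightarrow> c *\<^sub>R x \<in> D (c * \<sigma>)"
  by (auto simp: D_def)

lemma minus_D:
  assumes "x \<in> D \<rho>"
  shows "- x \<in> D \<rho>"
proof -
  obtain y where "y \<in> K" "x = \<rho> *\<^sub>R y" using assms by (auto simp: D_def)
  then show ?thesis using minus_mem[of y] unfolding D_def by (intro image_eqI[of _ _ "- y"]) auto
qed

text \<open>An object of size at least \<open>R\<close> contains a copy of itself of size exactly \<open>R\<close> around any of
  its points, so that large objects can be counted by volume near the place where they are met.\<close>

lemma card_near_le:
  fixes R L b :: real
  assumes "finite S" "thin t S" "F \<subseteq> S" "0 < R" "0 < b" "0 \<le> L"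
    and comp: "\<And>u. u \<in> F \<Longrightarrow> compact u" and conv: "\<And>u. u \<in> F \<Longrightarrow> convex u"
    and R: "\<And>u. u \<in> F \<Longrightarrow> R \<le> rad u"
    and diam: "\<And>u x y. u \<in> F \<Longrightarrow> x \<in> u \<Longrightarrow> y \<in> u \<Longrightarrow> x - y \<in> D (2 * rad u)"
    and vol: "\<And>u. u \<in> F \<Longrightarrow> rad u ^ DIM('a) * measure lebesgue K / b \<le> measure lebesgue u"
    and near: "\<And>u. u \<in> F \<Longrightarrow> \<exists>p\<in>u. p - z \<in> D (L * R)"
  shows "card F \<le> t * b * (L + 2) ^ DIM('a)"
proof -
  let ?V = "measure lebesgue K" and ?d = "DIM('a)"
  \<comment> \<open>\<open>L * R\<close> leads from \<open>z\<close> to a point \<open>p\<close> of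
    the object, and the copy shrunk towards \<open>p\<close> to size \<open>R\<close> has diameter
    at most \<open>2 * R\<close>.\<close>
  define \<Omega> where "\<Omega> = (+) z ` D ((L + 2) * R)"
  have "finite F" using assms finite_subset by blast
  have part: "R ^ ?d * ?V / b \<le> measure lebesgue (interior u \<inter> \<Omega>)" if "u \<in> F" for u
  proof -
    obtain p where p: "p \<in> u" "p - z \<in> D (L * R)" using near \<open>u \<in> F\<close> by blast
    have pos: "0 < rad u" using R[OF \<open>u \<in> F\<close>] \<open>0 < R\<close> by linarith
    define c where "c = R / rad u"
    have c: "0 < c" "c \<le> 1" "c * rad u = R"
      using pos \<open>0 < R\<close> R[OF \<open>u \<in> F\<close>] by (auto simp: c_def)
    define w where "w = (\<lambda>x. (1 - c) *\<^sub>R p + c *\<^sub>R x) ` u"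
    have "w \<subseteq> u" using p c conv[OF \<open>u \<in> F\<close>] by (auto simp: w_def convex_alt)
    have "w \<subseteq> \<Omega>"
    proof
      fix y assume "y \<in> w"
      then obtain x where x: "x \<in> u" "y = (1 - c) *\<^sub>R p + c *\<^sub>R x" by (auto simp: w_def)
      have "c *\<^sub>R (x - p) \<in> D (2 * R)"
        using scaleR_D[OF diam[OF \<open>u \<in> F\<close> x(1) p(1)], of c]
        unfolding c(3)[symmetric] by (simp add: mult_ac)
      from D_add[OF p(2) this] have "(p - z) + c *\<^sub>R (x - p) \<in> D ((L + 2) * R)"
        using \<open>0 < R\<close> \<open>0 \<le> L\<close> by (simp add: algebra_simps)
      moreover have "y = z + ((p - z) + c *\<^sub>R (x - p))" by (simp add: x algebra_simps)
      ultimately show "y \<in> \<Omega>" unfolding \<Omega>_def by blast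
    qed
    have w: "compact w" "convex w"
      unfolding w_def using comp[OF \<open>u \<in> F\<close>] conv[OF \<open>u \<in> F\<close>]
      by (auto intro!: compact_continuous_image continuous_intros convex_affinity)
    have "R ^ ?d * ?V / b = c ^ ?d * (rad u ^ ?d * ?V / b)"
      unfolding c(3)[symmetric] by (simp add: power_mult_distrib)
    also have "\<dots> \<le> c ^ ?d * measure lebesgue u"
      using vol[OF \<open>u \<in> F\<close>] c by (intro mult_left_mono) auto
    also have "\<dots> = measure lebesgue w"
      using measure_lebesgue_affine[of c "(1 - c) *\<^sub>R p" u] c by (simp add: w_def add.commute)
    also have "\<dots> = measure lebesgue (interior w)"
      using w by (intro measure_interior_convex[symmetric] compact_imp_bounded)
    also have "\<dots> \<le> measure lebesgue (interior u \<inter> \<Omega>)"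
    proof (rule measure_mono_fmeasurable)
      show "interior w \<subseteq> interior u \<inter> \<Omega>"
        using \<open>w \<subseteq> u\<close> \<open>w \<subseteq> \<Omega>\<close> interior_mono interior_subset by blast
      show "interior u \<inter> \<Omega> \<in> lmeasurable"
        unfolding \<Omega>_def using comp[OF \<open>u \<in> F\<close>]
        by (intro fmeasurable.Int lmeasurable_D_translate lmeasurable_interior compact_imp_bounded)
    qed (use w in \<open>auto simp: compact_imp_bounded lmeasurable_interior\<close>)
    finally show ?thesis .
  qed
  have "card F * (R ^ ?d * ?V / b) \<le> (\<Sum>u\<in>F. measure lebesgue (interior u \<inter> \<Omega>))"
    using sum_mono[OF part, of F] by simp
  also have "\<dots> \<le> t * measure lebesgue \<Omega>"
  proof (rule sum_measure_le_multiplicity[OF \<open>finite F\<close>])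
    fix x
    have "card {u\<in>F. x \<in> interior u \<inter> \<Omega>} \<le> card {u\<in>S. x \<in> interior u}"
      using assms by (intro card_mono) auto
    also have "\<dots> \<le> t" using \<open>thin t S\<close> by (simp add: thin_def)
    finally show "card {u\<in>F. x \<in> interior u \<inter> \<Omega>} \<le> t" .
  qed (use comp in \<open>auto simp: \<Omega>_def intro!: fmeasurable.Int lmeasurable_D_translate
        lmeasurable_interior compact_imp_bounded\<close>)
  also have "measure lebesgue \<Omega> = (L + 2) ^ ?d * R ^ ?d * ?V"
    using \<open>0 < R\<close> \<open>0 \<le> L\<close> by (simp add: \<Omega>_def measure_D_translate power_mult_distrib)
  finally have "(R ^ ?d * ?V) * card F \<le> (R ^ ?d * ?V) * (t * b * (L + 2) ^ ?d)"
    using \<open>0 < b\<close> by (simp add: field_simps)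
  then show ?thesis using measure_pos \<open>0 < R\<close> by (simp only: mult_le_cancel_left) simp
qed

text \<open>The first step leaves \<open>v\<close> at distance at most \<open>\<eta>\<close> from
  \<open>z\<close>, and each of the other \<open>n - 1\<close> steps crosses one object, of diameter
  at most \<open>2 * \<rho>\<close>. The bound on \<open>rad v\<close> covers walks that return to
  \<open>v\<close>.\<close>

lemma walk_to_near:
  fixes \<eta> \<rho> :: real
  assumes "walk_to adj v Q n x" "v \<in> S" "n \<noteq> 0"
    and adj: "\<And>x y. adj x y \<Longrightarrow> y \<in> S \<and> x \<inter> y \<noteq> {}"
    and diam: "\<And>u x y. u \<in> S \<Longrightarrow> x \<in> u \<Longrightarrow> y \<in> u \<Longrightarrow> x - y \<in> D (2 * rad u)"
    and rad: "\<And>u. u \<in> S \<Longrightarrow> 0 \<le> rad u"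
    and z: "\<And>x. x \<in> v \<Longrightarrow> x - z \<in> D \<eta>" and "0 \<le> \<eta>"
    and \<rho>: "rad v \<le> \<rho>" "\<And>y. y \<in> Q \<Longrightarrow> rad y \<le> \<rho>"
  shows "\<exists>p\<in>x. p - z \<in> D (\<eta> + 2 * (real n - 1) * \<rho>)"
  using assms(1,3)
proof induction
  case (step n y x)
  obtain p where p: "p \<in> y" "p \<in> x" using adj[OF \<open>adj y x\<close>] by blast
  show ?case
  proof (cases "n = 0")
    case True
    then have "y = v" using step.hyps(1) by (simp add: walk_to_0_iff)
    then show ?thesis using z p True by auto
  next
    case False
    then obtain p' where p': "p' \<in> y" "p' - z \<in> D (\<eta> + 2 * (real n - 1) * \<rho>)" using step.IH by blast
    have "y \<in> S" using walk_to_in[OF step.hyps(1) \<open>v \<in> S\<close>] adj by blast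
    have "rad y \<le> \<rho>" using step.hyps(2) \<rho> by blast
    then have "p - p' \<in> D (2 * \<rho>)" "0 \<le> \<rho>"
      using D_mono[OF diam[OF \<open>y \<in> S\<close> p(1) p'(1)], of "2 * \<rho>"] rad[OF \<open>y \<in> S\<close>] by auto
    then have "(p' - z) + (p - p') \<in> D (\<eta> + 2 * (real n - 1) * \<rho> + 2 * \<rho>)"
      using False \<open>0 \<le> \<eta>\<close> by (intro D_add p') auto
    then show ?thesis using p by (intro bexI[of _ p]) (auto simp: algebra_simps)
  qed
qed simp

end

section \<open>Weakly reachable objects\<close>

text \<open>Vertices after \<open>u\<close> in the order are no larger than \<open>u\<close>, so a
  witnessing path is a walk through objects of size at most \<open>rad u\<close>. The vertex
  \<open>v\<close> reaches itself and is split off; it becomes the summand 1 in the bounds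
  below.\<close>

lemma wreach_subset_walks:
  fixes rad :: "'v \<Rightarrow> real"
  assumes "S = fst G" "v \<in> S"
    and edge: "\<And>x y. {x, y} \<in> snd G \<Longrightarrow> adj x y"
    and order: "\<And>u w. u \<in> S \<Longrightarrow> w \<in> S \<Longrightarrow> (u, w) \<in> r \<Longrightarrow> u \<noteq> w \<Longrightarrow> rad w \<le> rad u"
  shows "wreach r k G v \<subseteq> insert v {u\<in>S. u \<noteq> v \<and> rad v \<le> rad u \<and>
    (\<exists>n\<le>k. walk_to adj v {y. rad y \<le> rad u} n u)}"
proof
  fix u assume "u \<in> wreach r k G v"
  then obtain p where u: "u \<in> S" "(u, v) \<in> r" and p: "is_path G v u p" "length p - 1 \<le> k"
    and inner: "\<forall>w\<in>set (butlast (tl p)). (u, w) \<in> r \<and> u \<noteq> w"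
    using \<open>S = fst G\<close> by (auto simp: wreach_def)
  have "set (butlast (tl p)) \<subseteq> set p"
    by (cases p) (auto dest: in_set_butlastD)
  then have "set (butlast (tl p)) \<subseteq> {y. rad y \<le> rad u}"
    using inner order u p(1) \<open>S = fst G\<close> unfolding is_path_def by blast
  moreover have "successively adj p"
    using p(1) edge unfolding is_path_def by (auto elim: successively_mono)
  ultimately have "walk_to adj v {y. rad y \<le> rad u} (length p - 1) u"
    using walk_to_of_path[of p v adj] p(1) unfolding is_path_def by auto
  then show "u \<in> insert v {u\<in>S. u \<noteq> v \<and> rad v \<le> rad u \<and>
    (\<exists>n\<le>k. walk_to adj v {y. rad y \<le> rad u} n u)}"
    using u p(2) order[of u v] \<open>v \<in> S\<close> by blast
qed

text \<open>The common setting of all three bounds. Sizes are measured in multiples of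
  \<open>K\<close>: the scaling factor for homothets, half the diameter when \<open>K\<close> is the
  unit ball. One-point objects have size 0, and \<open>rad_pos\<close> says that two different ones
  never meet.\<close>

locale object_system = symmetric_body K for K :: "'a::euclidean_space set" +
  fixes S :: "'a set set" and t :: nat and b :: real and rad :: "'a set \<Rightarrow> real"
  assumes finite_objects: "finite S" and thin: "thin t S" and b_ge_1: "1 \<le> b"
    and compact_object: "u \<in> S \<Longrightarrow> compact u" and convex_object: "u \<in> S \<Longrightarrow> convex u"
    and rad_nonneg: "u \<in> S \<Longrightarrow> 0 \<le> rad u"
    and rad_pos: "u \<in> S \<Longrightarrow> w \<in> S \<Longrightarrow> u \<noteq> w \<Longrightarrow> u \<inter> w \<noteq> {} \<Longrightarrow> 0 < rad u \<or> 0 < rad w"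
    and diff_mem_D: "u \<in> S \<Longrightarrow> x \<in> u \<Longrightarrow> y \<in> u \<Longrightarrow> x - y \<in> D (2 * rad u)"
    and volume: "u \<in> S \<Longrightarrow> rad u ^ DIM('a) * measure lebesgue K / b \<le> measure lebesgue u"
begin

lemma card_objects_near_le:
  fixes R L :: real
  assumes "0 < R" "0 \<le> L"
  shows "card {u\<in>S. R \<le> rad u \<and> (\<exists>p\<in>u. p - z \<in> D (L * R))} \<le> t * b * (L + 2) ^ DIM('a)"
  using assms b_ge_1
  by (intro card_near_le[OF finite_objects thin, where R = R and z = z and rad = rad])
     (auto intro: compact_object convex_object diff_mem_D volume)

text \<open>\<open>\<eta>\<close> measures how far \<open>v\<close> extends from the reference point
  \<open>z\<close>: 1 for a centre, 2 for an arbitrary point of \<open>v\<close>. A target in the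
  scale \<open>[R, 2R)\<close> is met within \<open>\<eta> * R + (k - 1) * 4R\<close> of
  \<open>z\<close>, and the volume bound adds \<open>2R\<close>; this gives the base
  \<open>4k - 2 + \<eta>\<close> of \<open>M\<close>.\<close>

lemma card_wreach_le:
  fixes r :: "'a set rel" and \<eta> M :: real
  assumes "v \<in> S" "1 \<le> k" "1 \<le> q" and \<eta>: "1 \<le> \<eta>" "\<eta> \<le> 2"
    and z: "\<And>x. x \<in> v \<Longrightarrow> x - z \<in> D (\<eta> * rad v)"
    and order: "\<And>u w. u \<in> S \<Longrightarrow> w \<in> S \<Longrightarrow> (u, w) \<in> r \<Longrightarrow> u \<noteq> w \<Longrightarrow> rad w \<le> rad u"
    and far: "\<And>R::real. 0 < R \<Longrightarrow> card {x\<in>S. 2 ^ q * R \<le> rad x \<and> (\<exists>p\<in>x. p - z \<in> D (2 * real k * R))} \<le> s"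
  defines "M \<equiv> t * b * (4 * real k - 2 + \<eta>) ^ DIM('a)"
  shows card_wreach_le_crude:
      "card (wreach r k (intersection_graph S) v) \<le> 1 + M * q * ((k + (s + 1)) choose (s + 1))"
    and card_wreach_le_refined:
      "card (wreach r k (intersection_graph S) v) \<le>
        1 + M * (((k + (s + 1)) choose (s + 1)) + q * ((k - 1 + (s + 1)) choose (s + 1)))"
proof -
  define adj where "adj x y \<longleftrightarrow> x \<in> S \<and> y \<in> S \<and> x \<noteq> y \<and> x \<inter> y \<noteq> {}" for x y :: "'a set"
  define U where "U = {u\<in>S. u \<noteq> v \<and> rad v \<le> rad u \<and>
    (\<exists>n\<le>k. walk_to adj v {y. rad y \<le> rad u} n u)}"
  have "finite U" using finite_objects by (simp add: U_def)
  have "wreach r k (intersection_graph S) v \<subseteq> insert v U"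
    unfolding U_def
    by (rule wreach_subset_walks)
       (use order \<open>v \<in> S\<close> in \<open>auto simp: intersection_graph_def adj_def doubleton_eq_iff\<close>)
  then have "card (wreach r k (intersection_graph S) v) \<le> card (insert v U)"
    using \<open>finite U\<close> by (intro card_mono) auto
  also have "\<dots> \<le> 1 + card U" by (simp add: card_insert_le_m1 card_insert_if \<open>finite U\<close>)
  finally have wreach_le: "real (card (wreach r k (intersection_graph S) v)) \<le> 1 + card U" by simp
  have "M \<ge> 0" using b_ge_1 \<open>1 \<le> k\<close> \<open>1 \<le> \<eta>\<close> unfolding M_def by (intro mult_nonneg_nonneg) auto
  have near: "\<exists>p\<in>x. p - z \<in> D L"
    if x: "walk_to adj v Q n x" "x \<noteq> v" "n \<le> k" and \<rho>: "rad v \<le> \<rho>" "\<And>y. y \<in> Q \<Longrightarrow> rad y \<le> \<rho>"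
      and L: "\<eta> * rad v + 2 * (real k - 1) * \<rho> \<le> L" for Q n x and \<rho> L :: real
  proof -
    have n: "n \<noteq> 0" using x by (auto simp: walk_to_0_iff)
    have v: "0 \<le> rad v" "0 \<le> \<eta> * rad v" using rad_nonneg[OF \<open>v \<in> S\<close>] \<open>1 \<le> \<eta>\<close> by auto
    obtain p where p: "p \<in> x" "p - z \<in> D (\<eta> * rad v + 2 * (real n - 1) * \<rho>)"
      using walk_to_near[OF x(1) \<open>v \<in> S\<close> n, where rad = rad and z = z and \<eta> = "\<eta> * rad v" and \<rho> = \<rho>]
        diff_mem_D rad_nonneg z v \<rho> unfolding adj_def by blast
    have "2 * (real n - 1) * \<rho> \<le> 2 * (real k - 1) * \<rho>"
      using \<open>n \<le> k\<close> \<rho>(1) v(1) by (intro mult_right_mono) auto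
    moreover have "0 \<le> 2 * (real n - 1) * \<rho>" using n \<rho>(1) v(1) by (intro mult_nonneg_nonneg) auto
    ultimately have "p - z \<in> D L" using L v by (intro D_mono[OF p(2)]) auto
    then show ?thesis using p by blast
  qed
  have bound: "real (card U) \<le> M * q * ((k + (s + 1)) choose (s + 1)) \<and>
      real (card U) \<le> M * (((k + (s + 1)) choose (s + 1)) + q * ((k - 1 + (s + 1)) choose (s + 1)))"
  proof (cases "U = {}")
    case True
    then show ?thesis using \<open>M \<ge> 0\<close> by simp
  next
    case False
    define R0 where "R0 = Min (rad ` U)"
    have R0_le: "R0 \<le> rad u" if "u \<in> U" for u
      using that \<open>finite U\<close> by (simp add: R0_def)
    have "R0 \<in> rad ` U"
      unfolding R0_def using False \<open>finite U\<close> by (intro Min_in) auto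
    then obtain u0 where u0: "u0 \<in> U" "R0 = rad u0" by blast
    have v_le: "rad v \<le> R0" using u0 by (simp add: U_def)
    \<comment> \<open>The last step into \<open>u0\<close> comes from a different object meeting it
      and no larger than it; if \<open>u0\<close> had size 0, so would that object, against
      \<open>rad_pos\<close>.\<close>
    have "0 < R0"
    proof -
      obtain n where "walk_to adj v {y. rad y \<le> rad u0} n u0" "u0 \<noteq> v"
        using u0 by (auto simp: U_def)
      then show ?thesis
      proof cases
        case (step m y)
        have "rad y \<le> rad u0" using step(3) u0(1) by (auto simp: U_def)
        then show ?thesis using rad_pos[of y u0] step(4) u0(2) unfolding adj_def by force
      qed simp
    qed
    have v0: "0 \<le> rad v" using rad_nonneg[OF \<open>v \<in> S\<close>] .
    have \<eta>_le: "\<eta> * rad v \<le> \<eta> * R" if "R0 \<le> R" for R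
      using that v_le \<open>1 \<le> \<eta>\<close> by (intro mult_left_mono) auto
    have scale: "real (card {u\<in>U. R \<le> rad u \<and> rad u < 2 * R}) \<le> M" if "R0 \<le> R" for R
    proof -
      have R: "0 < R" "rad v \<le> R" using that \<open>0 < R0\<close> v_le by auto
      have "{u\<in>U. R \<le> rad u \<and> rad u < 2 * R} \<subseteq>
          {u\<in>S. R \<le> rad u \<and> (\<exists>p\<in>u. p - z \<in> D ((4 * real k - 4 + \<eta>) * R))}"
      proof
        fix u assume "u \<in> {u\<in>U. R \<le> rad u \<and> rad u < 2 * R}"
        then have u: "u \<in> S" "u \<noteq> v" "R \<le> rad u" "rad u < 2 * R" "u \<in> U" by (auto simp: U_def)
        then obtain n where n: "n \<le> k" "walk_to adj v {y. rad y \<le> rad u} n u"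
          by (auto simp: U_def)
        have "\<exists>p\<in>u. p - z \<in> D ((4 * real k - 4 + \<eta>) * R)"
          by (rule near[OF n(2) u(2) n(1), where \<rho> = "2 * R"])
             (use u R \<eta>_le[OF that] in \<open>auto simp: algebra_simps\<close>)
        then show "u \<in> {u\<in>S. R \<le> rad u \<and> (\<exists>p\<in>u. p - z \<in> D ((4 * real k - 4 + \<eta>) * R))}"
          using u by blast
      qed
      then have "card {u\<in>U. R \<le> rad u \<and> rad u < 2 * R} \<le>
          card {u\<in>S. R \<le> rad u \<and> (\<exists>p\<in>u. p - z \<in> D ((4 * real k - 4 + \<eta>) * R))}"
        using finite_objects by (intro card_mono) auto
      moreover have "0 \<le> 4 * real k - 4 + \<eta>" using \<open>1 \<le> k\<close> \<open>1 \<le> \<eta>\<close> by simp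
      ultimately show ?thesis
        using card_objects_near_le[OF R(1), of "4 * real k - 4 + \<eta>" z]
        unfolding M_def by (simp add: add.commute add.left_commute)
    qed
    have far': "card {x\<in>S. x \<noteq> v \<and> 2 ^ q * R \<le> rad x \<and>
        (\<exists>n\<le>k. walk_to adj v {y. rad y < R} n x)} \<le> s" if "R0 \<le> R" for R
    proof -
      have R: "0 < R" "rad v \<le> R" using that \<open>0 < R0\<close> v_le by auto
      \<comment> \<open>Here \<open>\<eta> \<le> 2\<close> is what keeps the total
        \<open>\<eta> * R + 2 * (k - 1) * R\<close> within \<open>2 * k * R\<close>.\<close>
      have "\<eta> * R \<le> 2 * R" using R \<eta> by (intro mult_right_mono) auto
      then have "\<eta> * rad v \<le> 2 * R" using \<eta>_le[OF that] by linarith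
      then have "\<exists>p\<in>x. p - z \<in> D (2 * real k * R)"
        if "x \<noteq> v" "n \<le> k" "walk_to adj v {y. rad y < R} n x" for x n
        by (intro near[OF that(3,1,2), where \<rho> = R])
           (use R \<open>\<eta> * rad v \<le> 2 * R\<close> in \<open>auto simp: algebra_simps\<close>)
      then have "card {x\<in>S. x \<noteq> v \<and> 2 ^ q * R \<le> rad x \<and>
          (\<exists>n\<le>k. walk_to adj v {y. rad y < R} n x)} \<le>
          card {x\<in>S. 2 ^ q * R \<le> rad x \<and> (\<exists>p\<in>x. p - z \<in> D (2 * real k * R))}"
        using finite_objects by (intro card_mono) auto
      then show ?thesis using far[OF R(1)] by linarith
    qed
    have short: "real (card {x\<in>S. x \<noteq> v \<and> R \<le> rad x \<and>
        (\<exists>n\<le>k. walk_to adj v {y. rad y < R} n x)}) \<le> M" if "R0 \<le> R" for R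
    proof -
      have R: "0 < R" "rad v \<le> R" using that \<open>0 < R0\<close> v_le by auto
      \<comment> \<open>The objects in between now have size below \<open>R\<close> instead of
        \<open>2 * R\<close>, so the base is only \<open>2k + \<eta>\<close>; since
        \<open>k \<ge> 1\<close>, the bound \<open>M\<close> still covers it.\<close>
      have k: "0 \<le> 2 * real k - 2 + \<eta>" "2 * real k + \<eta> \<le> 4 * real k - 2 + \<eta>"
        using \<open>1 \<le> k\<close> \<open>1 \<le> \<eta>\<close> by auto
      have "\<exists>p\<in>x. p - z \<in> D ((2 * real k - 2 + \<eta>) * R)"
        if "x \<noteq> v" "n \<le> k" "walk_to adj v {y. rad y < R} n x" for x n
        by (rule near[OF that(3,1,2), where \<rho> = R])
           (use R \<eta>_le[OF \<open>R0 \<le> R\<close>] in \<open>auto simp: algebra_simps\<close>)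
      then have "card {x\<in>S. x \<noteq> v \<and> R \<le> rad x \<and> (\<exists>n\<le>k. walk_to adj v {y. rad y < R} n x)} \<le>
          card {x\<in>S. R \<le> rad x \<and> (\<exists>p\<in>x. p - z \<in> D ((2 * real k - 2 + \<eta>) * R))}"
        using finite_objects by (intro card_mono) auto
      also have "real \<dots> \<le> t * b * (2 * real k + \<eta>) ^ DIM('a)"
        using card_objects_near_le[OF R(1) k(1), of z] by (simp add: add.commute)
      also have "\<dots> \<le> M"
        unfolding M_def using k b_ge_1 \<open>1 \<le> \<eta>\<close> by (intro mult_left_mono power_mono) auto
      finally show ?thesis by simp
    qed
    have adj: "\<And>x y. adj x y \<Longrightarrow> y \<in> S" by (simp add: adj_def)
    have U: "U \<subseteq> {u\<in>S. u \<noteq> v \<and> (\<exists>n\<le>k. walk_to adj v {y. rad y \<le> rad u} n u)}"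
      by (auto simp: U_def)
    show ?thesis
    proof
      show "real (card U) \<le> M * q * ((k + (s + 1)) choose (s + 1))"
        by (rule card_targets_crude[OF finite_objects \<open>v \<in> S\<close> adj \<open>0 < R0\<close> \<open>1 \<le> q\<close> U R0_le
              scale far'])
      show "real (card U) \<le>
          M * (((k + (s + 1)) choose (s + 1)) + q * ((k - 1 + (s + 1)) choose (s + 1)))"
        by (rule card_targets_refined[OF finite_objects \<open>v \<in> S\<close> adj \<open>0 < R0\<close> \<open>1 \<le> q\<close> U R0_le
              scale far' short])
    qed
  qed
  show "card (wreach r k (intersection_graph S) v) \<le> 1 + M * q * ((k + (s + 1)) choose (s + 1))"
    using bound wreach_le by linarith
  show "card (wreach r k (intersection_graph S) v) \<le>
        1 + M * (((k + (s + 1)) choose (s + 1)) + q * ((k - 1 + (s + 1)) choose (s + 1)))"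
    using bound wreach_le by linarith
qed

end

section \<open>Homothets and ball-like objects\<close>

lemma wcol_le:
  assumes "finite S" "0 \<le> B" "\<And>v. v \<in> S \<Longrightarrow> real (card (wreach r k (intersection_graph S) v)) \<le> B"
  shows "real (wcol r k (intersection_graph S)) \<le> B"
proof (cases "S = {}")
  case False
  then have "Max ((\<lambda>v. card (wreach r k (intersection_graph S) v)) ` S)
      \<in> (\<lambda>v. card (wreach r k (intersection_graph S) v)) ` S"
    using \<open>finite S\<close> by (intro Max_in) auto
  then show ?thesis
    using False assms(3) by (auto simp: wcol_def intersection_graph_def)
qed (use \<open>0 \<le> B\<close> in \<open>simp add: wcol_def intersection_graph_def\<close>)

lemma le_two_power_ceiling_log:
  fixes k :: nat
  assumes "1 \<le> k"
  obtains m :: nat where "real_of_int (max 1 \<lceil>log 2 (real k)\<rceil>) = m" "1 \<le> m" "k \<le> 2 ^ m"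
proof
  let ?m = "nat (max 1 \<lceil>log 2 (real k)\<rceil>)"
  show "real_of_int (max 1 \<lceil>log 2 (real k)\<rceil>) = ?m" by simp
  show "1 \<le> ?m" by simp
  have "log 2 (real k) \<le> ?m" by linarith
  then have "real k \<le> 2 powr ?m" using assms by (subst (asm) log_le_iff) auto
  also have "\<dots> = 2 ^ ?m" by (rule powr_realpow) simp
  finally have "real k \<le> 2 ^ ?m" .
  then show "k \<le> 2 ^ ?m" by (metis of_nat_le_iff of_nat_numeral of_nat_power)
qed

text \<open>With lower index \<open>k\<close> the generalized binomial is a product of
  \<open>k\<close> factors \<open>x + i\<close>, divided by \<open>k!\<close>, and so grows with
  \<open>x\<close>.\<close>

lemma binomial_le_real_binomial:
  assumes "real n \<le> x"
  shows "real ((k + n) choose n) \<le> real_binomial (real k + x) x"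
proof -
  have "real ((k + n) choose n) = real_binomial (real k + real n) (real n)"
    using real_binomial_of_nat[of k n] by simp
  also have "\<dots> = (real k + real n) gchoose k" by (intro real_binomial_eq_gbinomial) simp
  also have "\<dots> \<le> (real k + x) gchoose k" using assms by (intro gbinomial_mono) auto
  also have "\<dots> = real_binomial (real k + x) x"
    using assms by (intro real_binomial_eq_gbinomial[symmetric]) linarith
  finally show ?thesis .
qed

context object_system
begin

text \<open>With level ratio \<open>2 ^ q \<ge> k\<close>, objects of size
  \<open>R' = 2 ^ q * R\<close> are met within \<open>2 * k * R \<le> 2 * R'\<close>. The volume
  bound with \<open>L = 2\<close> then gives \<open>s \<le> t * b * 4 ^ d\<close>, where
  \<open>d\<close> is the dimension.\<close>

lemma wcol_le_crude:
  fixes r :: "'a set rel" and \<eta> x :: real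
  assumes "1 \<le> t" "1 \<le> k" "1 \<le> q" "k \<le> 2 ^ q" and \<eta>: "1 \<le> \<eta>" "\<eta> \<le> 2"
    and center: "\<And>v. v \<in> S \<Longrightarrow> \<exists>z. \<forall>x\<in>v. x - z \<in> D (\<eta> * rad v)"
    and order: "\<And>u w. u \<in> S \<Longrightarrow> w \<in> S \<Longrightarrow> (u, w) \<in> r \<Longrightarrow> u \<noteq> w \<Longrightarrow> rad w \<le> rad u"
    and x: "t * b * 4 ^ DIM('a) + 2 \<le> x"
  shows "wcol r k (intersection_graph S) \<le>
    t * b * q * (4 * real k - 2 + \<eta>) ^ DIM('a) * real_binomial (real k + x) x"
proof -
  define s where "s = nat \<lfloor>t * b * 4 ^ DIM('a)\<rfloor>"
  define M where "M = t * b * (4 * real k - 2 + \<eta>) ^ DIM('a)"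
  let ?B = "(k + (s + 1)) choose (s + 1)" and ?B' = "(k + (s + 2)) choose (s + 2)"
  have "0 \<le> t * b * 4 ^ DIM('a)" using b_ge_1 by simp
  then have s: "real s \<le> t * b * 4 ^ DIM('a)" unfolding s_def by linarith
  have "1 * 1 * 1 \<le> M"
    unfolding M_def using \<open>1 \<le> t\<close> b_ge_1 \<open>1 \<le> k\<close> \<open>1 \<le> \<eta>\<close>
    by (intro mult_mono one_le_power) auto
  then have "1 \<le> M" by simp
  \<comment> \<open>Raising the lower index from \<open>s + 1\<close> to \<open>s + 2\<close> gains
    at least 1 by Pascal's rule, which absorbs the summand for \<open>v\<close>; hence the 2 added
    in the hypothesis on \<open>x\<close>.\<close>
  have B': "?B + 1 \<le> ?B'"
  proof -
    have "k + (s + 2) = Suc (k + (s + 1))" "s + 2 = Suc (s + 1)" by auto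
    then have "?B' = ?B + ((k + (s + 1)) choose Suc (s + 1))" by (metis binomial_Suc_Suc)
    moreover have "0 < (k + (s + 1)) choose Suc (s + 1)" using \<open>1 \<le> k\<close> by simp
    ultimately show ?thesis by linarith
  qed
  have far: "card {x\<in>S. 2 ^ q * R \<le> rad x \<and> (\<exists>p\<in>x. p - z \<in> D (2 * real k * R))} \<le> s"
    if "0 < R" for R z
  proof -
    have "real k \<le> 2 ^ q" using \<open>k \<le> 2 ^ q\<close> by (metis of_nat_le_iff of_nat_numeral of_nat_power)
    then have "2 * real k * R \<le> 2 * (2 ^ q * R)" using \<open>0 < R\<close> by simp
    then have "p \<in> D (2 * (2 ^ q * R))" if "p \<in> D (2 * real k * R)" for p
      using that \<open>0 < R\<close> by (intro D_mono[OF that]) auto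
    then have "card {x\<in>S. 2 ^ q * R \<le> rad x \<and> (\<exists>p\<in>x. p - z \<in> D (2 * real k * R))} \<le>
        card {x\<in>S. 2 ^ q * R \<le> rad x \<and> (\<exists>p\<in>x. p - z \<in> D (2 * (2 ^ q * R)))}"
      using finite_objects by (intro card_mono) auto
    also have "real \<dots> \<le> t * b * 4 ^ DIM('a)"
      using card_objects_near_le[of "2 ^ q * R" 2 z] \<open>0 < R\<close> by simp
    finally show ?thesis unfolding s_def by linarith
  qed
  have "real (card (wreach r k (intersection_graph S) v)) \<le> M * q * ?B'" if v: "v \<in> S" for v
  proof -
    obtain z where z: "\<And>x. x \<in> v \<Longrightarrow> x - z \<in> D (\<eta> * rad v)" using center[OF v] by blast
    have "real (card (wreach r k (intersection_graph S) v)) \<le> 1 + M * q * ?B"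
      unfolding M_def
      by (rule card_wreach_le_crude[OF v \<open>1 \<le> k\<close> \<open>1 \<le> q\<close> \<eta> z order far])
    also have "1 * 1 \<le> M * q" using \<open>1 \<le> M\<close> \<open>1 \<le> q\<close> by (intro mult_mono) auto
    then have "1 + M * q * ?B \<le> M * q * (?B + 1)" by (simp add: algebra_simps)
    also have "real (?B + 1) \<le> ?B'" using B' by (simp only: of_nat_le_iff)
    then have "M * q * (?B + 1) \<le> M * q * ?B'" using \<open>1 \<le> M\<close> by (intro mult_left_mono) auto
    finally show ?thesis .
  qed
  then have "real (wcol r k (intersection_graph S)) \<le> M * q * ?B'"
    using \<open>1 \<le> M\<close> by (intro wcol_le finite_objects) auto
  also have "\<dots> \<le> M * q * real_binomial (real k + x) x"
    using \<open>1 \<le> M\<close> s x by (intro mult_left_mono binomial_le_real_binomial) auto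
  finally show ?thesis by (simp add: M_def mult_ac)
qed

end

lemma diameter_scaled_translate:
  fixes K :: "'a::euclidean_space set"
  assumes "compact K" "K \<noteq> {}" "0 < c"
  shows "diameter ((\<lambda>x. a + c *\<^sub>R x) ` K) = c * diameter K"
proof (rule antisym)
  have dist: "dist (a + c *\<^sub>R x) (a + c *\<^sub>R y) = c * dist x y" for x y
    using \<open>0 < c\<close> by (simp add: dist_norm flip: scaleR_diff_right)
  show "diameter ((\<lambda>x. a + c *\<^sub>R x) ` K) \<le> c * diameter K"
  proof (rule diameter_le)
    fix x y assume "x \<in> (\<lambda>x. a + c *\<^sub>R x) ` K" "y \<in> (\<lambda>x. a + c *\<^sub>R x) ` K"
    then obtain x' y' where "x' \<in> K" "y' \<in> K" "x = a + c *\<^sub>R x'" "y = a + c *\<^sub>R y'" by blast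
    moreover from this have "dist x' y' \<le> diameter K"
      using diameter_bounded_bound compact_imp_bounded[OF \<open>compact K\<close>] by blast
    ultimately show "norm (x - y) \<le> c * diameter K"
      using dist \<open>0 < c\<close> by (simp flip: dist_norm)
  qed (use \<open>K \<noteq> {}\<close> in auto)
  obtain x y where xy: "x \<in> K" "y \<in> K" "dist x y = diameter K"
    using diameter_compact_attained[OF \<open>compact K\<close> \<open>K \<noteq> {}\<close>] by blast
  have "bounded ((\<lambda>x. a + c *\<^sub>R x) ` K)"
    using \<open>compact K\<close>
    by (intro compact_imp_bounded compact_continuous_image continuous_intros)
  then show "c * diameter K \<le> diameter ((\<lambda>x. a + c *\<^sub>R x) ` K)"
    using diameter_bounded_bound[of _ "a + c *\<^sub>R x" "a + c *\<^sub>R y"] xy dist[of x y] by auto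
qed

lemma sizewise_diameter:
  assumes "sizewise S r" "u \<in> S" "w \<in> S" "(u, w) \<in> r" "u \<noteq> w"
  shows "diameter w \<le> diameter u"
  using assms unfolding sizewise_def by blast

text \<open>Moving the centre of \<open>K\<close> to the origin gives a body \<open>K0\<close> for
  which every object is a translate of \<open>D (rad v)\<close>. Hence the centre of
  \<open>v\<close> serves as \<open>z\<close> with \<open>\<eta> = 1\<close>, and volumes are exact,
  so \<open>b = 1\<close>.\<close>

lemma wcol_homothets:
  fixes S :: "'a::euclidean_space set set"
  assumes "1 \<le> t" "finite S" "thin t S" "sizewise S r" "1 \<le> k"
    and K: "compact K" "convex K" "interior K \<noteq> {}" "centrally_symmetric K"
    and copies: "\<forall>v\<in>S. scaled_translate K v"
  shows "real (wcol r k (intersection_graph S)) \<le>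
    real t * real_of_int (max 1 \<lceil>log 2 (real k)\<rceil>) * (4 * real k - 1) ^ DIM('a) *
    real ((k + t * 5 ^ DIM('a) + 2) choose (t * 5 ^ DIM('a) + 2))"
proof -
  obtain z where z: "\<And>x. x \<in> K \<Longrightarrow> 2 *\<^sub>R z - x \<in> K"
    using K(4) by (auto simp: centrally_symmetric_def)
  obtain w e where w: "0 < e" "ball w e \<subseteq> K" using K(3) by (meson ex_in_conv mem_interior)
  define K0 where "K0 = (\<lambda>x. - z + 1 *\<^sub>R x) ` K"
  have "bounded K" using K(1) by (rule compact_imp_bounded)
  have "K \<noteq> {}" using K(3) by auto
  have "0 < diameter K"
    using diameter_subset[OF w(2) \<open>bounded K\<close>] w(1) by simp
  have "0 < measure lebesgue (ball w e)" using content_ball_pos[OF w(1)] by simp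
  also have "\<dots> \<le> measure lebesgue K"
    using w(2) K(1) by (intro measure_mono_fmeasurable) (auto intro: lmeasurable_compact)
  finally have "0 < measure lebesgue K" .
  moreover have K0_measure: "measure lebesgue K0 = measure lebesgue K"
    unfolding K0_def using measure_lebesgue_affine[of 1 "- z" K] by (simp add: add.commute)
  ultimately interpret body: symmetric_body K0
  proof unfold_locales
    show "compact K0" unfolding K0_def using K(1)
      by (intro compact_continuous_image continuous_intros)
    show "convex K0" unfolding K0_def using K(2) by (intro convex_affinity)
    fix x assume "x \<in> K0"
    then have "2 *\<^sub>R z - (x + z) \<in> K" by (intro z) (auto simp: K0_def)
    then have "- z + 1 *\<^sub>R (2 *\<^sub>R z - (x + z)) \<in> K0" unfolding K0_def by (rule imageI)
    then show "- x \<in> K0" by (simp add: scaleR_2)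
  qed simp
  \<comment> \<open>This quotient recovers the scaling factor, so that an ordering by diameter is an
    ordering by \<open>rad\<close>.\<close>
  define rad where "rad v = diameter v / diameter K" for v :: "'a set"
  have shape: "\<exists>a. 0 < rad v \<and> v = (\<lambda>x. a + rad v *\<^sub>R x) ` K0" if v: "v \<in> S" for v
  proof -
    obtain c a where c: "0 < c" "v = (\<lambda>x. a + c *\<^sub>R x) ` K"
      using copies v unfolding scaled_translate_def by blast
    then have "rad v = c"
      using diameter_scaled_translate[OF K(1) \<open>K \<noteq> {}\<close> c(1)] \<open>0 < diameter K\<close> by (simp add: rad_def)
    moreover have "v = (\<lambda>x. (a + c *\<^sub>R z) + c *\<^sub>R x) ` K0"
      unfolding c(2) K0_def image_image by (simp add: algebra_simps)
    ultimately show ?thesis using c(1) by blast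
  qed
  have center: "\<exists>z. \<forall>x\<in>v. x - z \<in> body.D (rad v)" if "v \<in> S" for v
    using shape[OF that] by (force simp: body.D_def)
  have pos: "0 < rad v" if "v \<in> S" for v
    using shape[OF that] by blast
  interpret object_system K0 S t 1 rad
  proof unfold_locales
    fix u assume "u \<in> S"
    then obtain a c where a: "0 < c" "rad u = c" "u = (\<lambda>x. a + c *\<^sub>R x) ` K0"
      using shape by blast
    show "0 \<le> rad u" using a(1,2) by simp
    show "compact u"
      unfolding a(3) by (intro compact_continuous_image continuous_intros body.compact)
    show "convex u" unfolding a(3) by (intro convex_affinity body.convex)
    show "rad u ^ DIM('a) * measure lebesgue K0 / 1 \<le> measure lebesgue u"
      unfolding a(2) unfolding a(3)
      using measure_lebesgue_affine[of c a K0] a(1) by (simp add: add.commute)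
    obtain z where z: "\<forall>x\<in>u. x - z \<in> body.D (rad u)" using center[OF \<open>u \<in> S\<close>] by blast
    fix x y assume "x \<in> u" "y \<in> u"
    then have "x - z \<in> body.D (rad u)" "z - y \<in> body.D (rad u)"
      using z body.minus_D[of "y - z" "rad u"] by auto
    then show "x - y \<in> body.D (2 * rad u)"
      using body.D_add[of "x - z" "rad u" "z - y" "rad u"] a(1,2) by simp
  next
    show "0 < rad u \<or> 0 < rad w" if "u \<in> S" for u w
      using pos[OF that] ..
    show "finite S" "thin t S" by fact+
    show "(1::real) \<le> 1" by simp
  qed
  obtain q :: nat where q: "real_of_int (max 1 \<lceil>log 2 (real k)\<rceil>) = q" "1 \<le> q" "k \<le> 2 ^ q"
    using le_two_power_ceiling_log[OF \<open>1 \<le> k\<close>] .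
  have x: "real t * 1 * 4 ^ DIM('a) + 2 \<le> real (t * 5 ^ DIM('a) + 2)"
    using power_mono[of "4::real" 5 "DIM('a)"] by (simp add: mult_left_mono)
  have order: "rad w \<le> rad u" if "u \<in> S" "w \<in> S" "(u, w) \<in> r" "u \<noteq> w" for u w
    using sizewise_diameter[OF \<open>sizewise S r\<close> that] \<open>0 < diameter K\<close>
    by (simp add: rad_def divide_right_mono)
  have "real (wcol r k (intersection_graph S)) \<le>
      real t * 1 * real q * (4 * real k - 2 + 1) ^ DIM('a) *
      real_binomial (real k + real (t * 5 ^ DIM('a) + 2)) (real (t * 5 ^ DIM('a) + 2))"
    by (rule wcol_le_crude[OF assms(1,5) q(2,3) _ _ _ order x]) (use center in auto)
  moreover have "real_binomial (real k + real (t * 5 ^ DIM('a) + 2)) (real (t * 5 ^ DIM('a) + 2)) =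
      real ((k + t * 5 ^ DIM('a) + 2) choose (t * 5 ^ DIM('a) + 2))"
    using real_binomial_of_nat[of k "t * 5 ^ DIM('a) + 2"] by (simp only: of_nat_add add.assoc)
  ultimately show ?thesis unfolding q(1) by simp
qed

lemma symmetric_body_cball: "symmetric_body (cball (0::'a::euclidean_space) 1)"
  by unfold_locales (simp_all add: content_cball_pos)

lemma D_cball: "0 \<le> \<rho> \<Longrightarrow> symmetric_body.D (cball (0::'a::euclidean_space) 1) \<rho> = cball 0 \<rho>"
  using cball_scale[of \<rho> "0::'a" 1]
  by (cases "\<rho> = 0") (auto simp: symmetric_body.D_def[OF symmetric_body_cball] image_constant_conv)

lemma object_system_ball_like:
  fixes S :: "'a::euclidean_space set set"
  assumes "finite S" "thin t S" "1 \<le> b" "\<forall>v\<in>S. ball_like b v"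
  shows "object_system (cball 0 1) S t b (\<lambda>v. diameter v / 2)"
proof -
  interpret symmetric_body "cball (0::'a) 1" by (rule symmetric_body_cball)
  show ?thesis
  proof unfold_locales
    fix u assume "u \<in> S"
    then have u: "compact u" "convex u"
        "measure lebesgue (cball (0::'a) (diameter u / 2)) / b \<le> measure lebesgue u"
      using assms(4) by (auto simp: ball_like_def)
    have "bounded u" using u(1) by (rule compact_imp_bounded)
    then have d: "0 \<le> diameter u" by (rule diameter_ge_0)
    then show "0 \<le> diameter u / 2" by simp
    show "compact u" "convex u" by fact+
    have "measure lebesgue (cball (0::'a) (diameter u / 2)) =
        (diameter u / 2) ^ DIM('a) * measure lebesgue (cball (0::'a) 1)"
      using measure_D_translate[of "diameter u / 2" 0] d by (simp add: D_cball)
    then show "(diameter u / 2) ^ DIM('a) * measure lebesgue (cball (0::'a) 1) / b \<le>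
        measure lebesgue u"
      using u(3) by simp
    { fix x y assume "x \<in> u" "y \<in> u"
      then have "dist x y \<le> diameter u" using diameter_bounded_bound \<open>bounded u\<close> by blast
      then show "x - y \<in> D (2 * (diameter u / 2))"
        using d by (simp add: D_cball dist_norm norm_minus_commute) }
    fix w assume w: "w \<in> S" "u \<noteq> w" "u \<inter> w \<noteq> {}"
    show "0 < diameter u / 2 \<or> 0 < diameter w / 2"
    \<comment> \<open>Two objects of diameter 0 with a common point \<open>p\<close> both equal
      \<open>{p}\<close>.\<close>
    proof (rule ccontr)
      assume "\<not> (0 < diameter u / 2 \<or> 0 < diameter w / 2)"
      then have neg: "diameter u \<le> 0" "diameter w \<le> 0" by auto
      have "bounded w" using assms(4) w(1) by (auto simp: ball_like_def intro: compact_imp_bounded)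
      obtain p where p: "p \<in> u" "p \<in> w" using w by blast
      have "x = p" if "x \<in> u" for x
        using diameter_bounded_bound[OF \<open>bounded u\<close> that p(1)] neg
        by (metis dist_le_zero_iff order_trans)
      moreover have "x = p" if "x \<in> w" for x
        using diameter_bounded_bound[OF \<open>bounded w\<close> that p(2)] neg
        by (metis dist_le_zero_iff order_trans)
      ultimately have "u = w" using p by blast
      then show False using w by simp
    qed
  qed (use assms in \<open>simp_all only:\<close>)
qed

lemma wcol_ball_like:
  fixes S :: "'a::euclidean_space set set" and b :: real
  assumes "1 \<le> t" "finite S" "thin t S" "sizewise S r" "1 \<le> k" "1 \<le> b"
    and "\<forall>v\<in>S. ball_like b v" and "\<forall>v\<in>S. v \<noteq> {}"
  shows "real (wcol r k (intersection_graph S)) \<le>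
    real t * b * real_of_int (max 1 \<lceil>log 2 (real k)\<rceil>) * (4 * real k) ^ DIM('a) *
    real_binomial (real k + real t * b * 6 ^ DIM('a) + 2) (real t * b * 6 ^ DIM('a) + 2)"
proof -
  interpret object_system "cball 0 1" S t b "\<lambda>v. diameter v / 2"
    using assms by (intro object_system_ball_like)
  obtain q :: nat where q: "real_of_int (max 1 \<lceil>log 2 (real k)\<rceil>) = q" "1 \<le> q" "k \<le> 2 ^ q"
    using le_two_power_ceiling_log[OF \<open>1 \<le> k\<close>] .
  have x: "real t * b * (4 ^ DIM('a)) + 2 \<le> real t * b * (6 ^ DIM('a)) + 2"
    using \<open>1 \<le> b\<close> by (intro add_mono mult_left_mono power_mono) auto
  \<comment> \<open>A ball-like object need not fit into a ball of radius half its diameter, so any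
    of its points is taken as \<open>z\<close>. This costs \<open>\<eta> = 2\<close> and leads to
    the base \<open>4k\<close>.\<close>
  have center: "\<exists>z. \<forall>x\<in>v. x - z \<in> D (2 * (diameter v / 2))" if "v \<in> S" for v
    using assms(8) that diff_mem_D[OF that] by (meson ex_in_conv)
  have "real (wcol r k (intersection_graph S)) \<le>
      real t * b * real q * (4 * real k - 2 + 2) ^ DIM('a) *
      real_binomial (real k + (real t * b * 6 ^ DIM('a) + 2)) (real t * b * 6 ^ DIM('a) + 2)"
    by (rule wcol_le_crude[OF assms(1,5) q(2,3) _ _ center _ x])
       (use sizewise_diameter[OF \<open>sizewise S r\<close>] in auto)
  then show ?thesis unfolding q(1) by (simp add: add.assoc)
qed

section \<open>Balls\<close>

text \<open>About \<open>P / (3h)\<close> disjoint translates of the slab along \<open>e\<close> fit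
  into the ball of radius \<open>2 * P\<close>, whose volume is \<open>2 ^ d\<close> times that of
  radius \<open>P\<close> in dimension \<open>d\<close>.\<close>

lemma measure_slab_le:
  fixes e :: "'a::euclidean_space"
  assumes "norm e = 1" "0 < h" "0 < P"
  shows "measure lebesgue {w \<in> cball 0 P. \<bar>w \<bullet> e\<bar> \<le> h} \<le>
    3 * 2 ^ DIM('a) * (h / P) * measure lebesgue (cball (0::'a) P)"
proof -
  interpret symmetric_body "cball (0::'a) 1" by (rule symmetric_body_cball)
  define W where "W = {w \<in> cball 0 P. \<bar>w \<bullet> e\<bar> \<le> h}"
  define N where "N = nat \<lfloor>P / (3 * h)\<rfloor>"
  \<comment> \<open>Spacing \<open>3 * h\<close> exceeds the width \<open>2 * h\<close>, which makes
    the translates disjoint, and \<open>N\<close> is chosen so that no shift exceeds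
    \<open>P\<close>.\<close>
  define T where "T i = (+) ((3 * h * real i) *\<^sub>R e) ` W" for i
  have N: "real N \<le> P / (3 * h)" "P / (3 * h) < real N + 1"
    using assms unfolding N_def by (auto simp: of_nat_nat)
  have "compact W"
  proof -
    have "W = cball 0 P \<inter> {w. e \<bullet> w \<le> h} \<inter> {w. - h \<le> e \<bullet> w}"
      unfolding W_def by (auto simp: inner_commute abs_le_iff)
    then show ?thesis
      by (auto intro!: compact_Int_closed closed_halfspace_le closed_halfspace_ge)
  qed
  then have T_meas: "T i \<in> lmeasurable" for i
    unfolding T_def by (intro lmeasurable_compact compact_translation)
  have "(\<Sum>i\<in>{..N}. measure lebesgue (T i)) \<le> real 1 * measure lebesgue (cball (0::'a) (2 * P))"
  proof (rule sum_measure_le_multiplicity)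
    fix i assume "i \<in> {..N}"
    then have "3 * h * real i \<le> 3 * h * real N" using \<open>0 < h\<close> by simp
    also have "\<dots> \<le> P" using N(1) \<open>0 < h\<close> by (simp add: field_simps)
    finally have i: "3 * h * real i \<le> P" .
    show "T i \<subseteq> cball 0 (2 * P)"
    proof
      fix x assume "x \<in> T i"
      then obtain w where w: "norm w \<le> P" "x = (3 * h * real i) *\<^sub>R e + w"
        by (auto simp: T_def W_def)
      have "norm x \<le> norm ((3 * h * real i) *\<^sub>R e) + norm w" unfolding w(2) by (rule norm_triangle_ineq)
      also have "norm ((3 * h * real i) *\<^sub>R e) = 3 * h * real i" using assms by simp
      finally show "x \<in> cball 0 (2 * P)" using i w(1) by simp
    qed
  next
    fix x
    have "i = j" if "x \<in> T i" "x \<in> T j" for i j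
    proof -
      have strip: "\<bar>x \<bullet> e - 3 * h * real l\<bar> \<le> h" if "x \<in> T l" for l
        using that \<open>norm e = 1\<close>
        by (auto simp: T_def W_def inner_add_left dot_square_norm)
      have "3 * h * \<bar>real i - real j\<bar> = \<bar>3 * h * real i - 3 * h * real j\<bar>"
        using \<open>0 < h\<close> by (simp add: abs_mult flip: right_diff_distrib)
      also have "\<dots> \<le> 2 * h" using strip[OF that(1)] strip[OF that(2)] by linarith
      finally have "\<bar>real i - real j\<bar> < 1" using \<open>0 < h\<close> by simp
      then show ?thesis by linarith
    qed
    then show "card {i \<in> {..N}. x \<in> T i} \<le> 1" by (auto simp: card_le_Suc0_iff_eq)
  qed (use T_meas in auto)
  moreover have "measure lebesgue (T i) = measure lebesgue W" for i
    unfolding T_def by (rule measure_translation)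
  ultimately have "(real N + 1) * measure lebesgue W \<le> measure lebesgue (cball (0::'a) (2 * P))"
    by (simp add: add.commute)
  moreover have "P / (3 * h) * measure lebesgue W \<le> (real N + 1) * measure lebesgue W"
    using N by (intro mult_right_mono) auto
  moreover have "measure lebesgue (cball (0::'a) (2 * P)) = 2 ^ DIM('a) * measure lebesgue (cball (0::'a) P)"
    using measure_D_translate[of "2 * P" 0] measure_D_translate[of P 0] \<open>0 < P\<close>
    by (simp add: D_cball power_mult_distrib)
  ultimately have "P / (3 * h) * measure lebesgue W \<le> 2 ^ DIM('a) * measure lebesgue (cball (0::'a) P)"
    by linarith
  then show ?thesis unfolding W_def[symmetric] using \<open>0 < h\<close> \<open>0 < P\<close> by (simp add: field_simps)
qed

text \<open>On the scale \<open>\<rho>R\<close>, a ball of radius at least \<open>R\<close> passing within \<open>\<rho>\<^sup>2R\<close> of \<open>z\<close> is almost a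
  half-space through \<open>z\<close> (or contains it), hence covers nearly half of the ball of radius \<open>\<rho>R\<close>
  around \<open>z\<close>: its complement and the reflection of its complement meet only in a thin slab.\<close>

lemma card_large_balls_le:
  fixes S :: "'a::euclidean_space set set" and R \<rho> :: real
  assumes "finite S" "thin t S" "\<forall>v\<in>S. is_ball v" "0 < R" "0 < \<rho>" "\<rho> \<le> 1 / 2"
  shows "card {u\<in>S. R \<le> diameter u / 2 \<and> (\<exists>p\<in>u. dist z p \<le> \<rho>\<^sup>2 * R)} * (1 - 12 * 2 ^ DIM('a) * \<rho>) \<le> 2 * t"
proof -
  define F where "F = {u\<in>S. R \<le> diameter u / 2 \<and> (\<exists>p\<in>u. dist z p \<le> \<rho>\<^sup>2 * R)}"
  define P where "P = \<rho> * R"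
  define B where "B = cball (0::'a) P"
  define V where "V = measure lebesgue B"
  define A :: real where "A = 12 * 2 ^ DIM('a)"
  have "0 < P" using assms by (simp add: P_def)
  have "0 < V" using \<open>0 < P\<close> content_cball_pos[of P "0::'a"] by (simp add: V_def B_def)
  have B: "B \<in> lmeasurable" by (simp add: B_def)
  define G where "G u = B \<inter> (+) (- z) ` interior u" for u
  have G_iff: "w \<in> G u \<longleftrightarrow> w \<in> B \<and> z + w \<in> interior u" for w u
    by (auto simp: G_def image_iff algebra_simps)
  have ball: "\<exists>c r. R \<le> r \<and> u = cball c r" if "u \<in> F" for u
    using that assms(3) unfolding F_def is_ball_def by force
  have G: "G u \<in> lmeasurable" if "u \<in> F" for u
  proof -
    have "bounded u" using ball[OF that] bounded_cball by blast
    then show ?thesis unfolding G_def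
      by (intro fmeasurable.Int B lmeasurable_open open_translation bounded_translation
          bounded_interior open_interior)
  qed
  \<comment> \<open>The part of \<open>B\<close> covered by \<open>u\<close> and its mirror image
    have equal volume; together with the slab containing \<open>bad\<close> they cover
    \<open>B\<close>.\<close>
  have half: "V * (1 - A * \<rho>) \<le> 2 * measure lebesgue (G u)" if "u \<in> F" for u
  proof -
    obtain c r where u: "R \<le> r" "u = cball c r" using ball[OF \<open>u \<in> F\<close>] by blast
    have "0 < r" using u(1) \<open>0 < R\<close> by linarith
    define a where "a = c - z"
    obtain p where p: "dist c p \<le> r" "dist z p \<le> \<rho>\<^sup>2 * R"
      using \<open>u \<in> F\<close> u(2) by (auto simp: F_def)
    have "dist c z \<le> dist c p + dist z p" by (rule dist_triangle2)
    then have a_le: "norm a \<le> r + \<rho>\<^sup>2 * R" using p by (simp add: a_def dist_norm)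
    have uncovered: "norm (w - a) \<ge> r" if "z + w \<notin> interior u" for w
      using that \<open>0 < r\<close> unfolding u(2)
      by (simp add: interior_cball a_def dist_norm norm_minus_commute algebra_simps)
    \<comment> \<open>If neither \<open>z + w\<close> nor \<open>z - w\<close> is covered,
      \<open>w\<close> and \<open>- w\<close> both have distance at least \<open>r\<close> from
      \<open>a\<close>, although \<open>a\<close> has norm at most
      \<open>r + \<rho>\<^sup>2 * R\<close>. Expanding both squares bounds
      \<open>w \<bullet> a\<close>; and \<open>\<rho> \<le> 1 / 2\<close> keeps \<open>a\<close>
      away from 0, so that it gives a direction.\<close>
    have slab: "norm a \<ge> r / 2 \<and> \<bar>w \<bullet> a\<bar> \<le> 2 * \<rho>\<^sup>2 * r * R"
      if "w \<in> B" "z + w \<notin> interior u" "z - w \<notin> interior u" for w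
    proof -
      have n: "r \<le> norm (w - a)" "r \<le> norm (- w - a)"
        using uncovered[of w] uncovered[of "- w"] that by auto
      have w: "norm w \<le> \<rho> * R" using that(1) by (simp add: B_def P_def)
      have "\<rho> * R \<le> 1 / 2 * r" using assms u(1) by (intro mult_mono) auto
      moreover have "norm (w - a) \<le> norm w + norm a" by (rule norm_triangle_ineq4)
      ultimately have "norm a \<ge> r / 2" using n(1) w by linarith
      have sq: "r\<^sup>2 \<le> (norm (w - a))\<^sup>2" "r\<^sup>2 \<le> (norm (- w - a))\<^sup>2"
        using n \<open>0 < r\<close> by (auto intro!: power_mono)
      have "(norm (w - a))\<^sup>2 = (norm w)\<^sup>2 + (norm a)\<^sup>2 - 2 * (w \<bullet> a)"
        "(norm (- w - a))\<^sup>2 = (norm w)\<^sup>2 + (norm a)\<^sup>2 + 2 * (w \<bullet> a)"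
        by (simp_all add: power2_norm_eq_inner inner_diff_left inner_diff_right inner_commute)
      then have "2 * \<bar>w \<bullet> a\<bar> \<le> (norm w)\<^sup>2 + (norm a)\<^sup>2 - r\<^sup>2" using sq by linarith
      also have "\<dots> \<le> (\<rho> * R)\<^sup>2 + (r + \<rho>\<^sup>2 * R)\<^sup>2 - r\<^sup>2"
        using w a_le by (intro add_mono diff_right_mono power_mono) auto
      also have "\<dots> = \<rho>\<^sup>2 * (R * R) + 2 * \<rho>\<^sup>2 * (r * R) + \<rho>\<^sup>2 * (\<rho>\<^sup>2 * (R * R))"
        by (simp add: power2_eq_square algebra_simps)
      also have "\<dots> \<le> \<rho>\<^sup>2 * (r * R) + 2 * \<rho>\<^sup>2 * (r * R) + \<rho>\<^sup>2 * (1 * (r * R))"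
      proof -
        have "\<rho>\<^sup>2 \<le> 1" using assms by (intro power_le_one) auto
        then show ?thesis using u(1) \<open>0 < R\<close>
          by (intro add_mono mult_left_mono mult_mono mult_right_mono) auto
      qed
      finally show ?thesis using \<open>norm a \<ge> r / 2\<close> by (simp add: algebra_simps)
    qed
    define bad where "bad = {w\<in>B. z + w \<notin> interior u \<and> z - w \<notin> interior u}"
    have bad: "\<exists>W\<in>lmeasurable. bad \<subseteq> W \<and> measure lebesgue W \<le> A * \<rho> * V"
    proof (cases "bad = {}")
      case True
      then show ?thesis using \<open>0 < V\<close> \<open>0 < \<rho>\<close> by (intro bexI[of _ "{}"]) (auto simp: A_def)
    next
      case False
      then obtain w0 where "w0 \<in> bad" by blast
      then have na: "norm a \<ge> r / 2" using slab[of w0] by (simp add: bad_def)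
      then have "0 < norm a" using \<open>0 < r\<close> by linarith
      define e where "e = a /\<^sub>R norm a"
      \<comment> \<open>Dividing \<open>2 * \<rho>\<^sup>2 * r * R\<close> by
        \<open>norm a \<ge> r / 2\<close> gives this half-width. Relative to
        \<open>P = \<rho> * R\<close> it is \<open>4 * \<rho>\<close>, so the slab takes at most a
        fraction \<open>A * \<rho>\<close> of the volume of \<open>B\<close>.\<close>
      let ?h = "4 * \<rho>\<^sup>2 * R"
      have "\<bar>w \<bullet> e\<bar> \<le> ?h" if "w \<in> bad" for w
      proof -
        have "\<bar>w \<bullet> a\<bar> \<le> 2 * \<rho>\<^sup>2 * r * R" using slab[of w] that by (simp add: bad_def)
        also have "\<dots> = ?h * (r / 2)" by simp
        also have "\<dots> \<le> ?h * norm a" using na \<open>0 < R\<close> by (intro mult_left_mono) auto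
        finally have "\<bar>w \<bullet> a\<bar> / norm a \<le> ?h"
          using \<open>0 < norm a\<close> by (subst pos_divide_le_eq)
        moreover have "w \<bullet> e = (w \<bullet> a) / norm a"
          by (simp add: e_def divide_inverse mult.commute)
        ultimately show ?thesis by (simp only: abs_divide abs_norm_cancel)
      qed
      then have "bad \<subseteq> {w \<in> cball 0 P. \<bar>w \<bullet> e\<bar> \<le> ?h}" by (auto simp: bad_def B_def)
      moreover have "measure lebesgue {w \<in> cball 0 P. \<bar>w \<bullet> e\<bar> \<le> ?h} \<le> 3 * 2 ^ DIM('a) * (?h / P) * V"
        unfolding V_def B_def using \<open>0 < norm a\<close> \<open>0 < P\<close> assms
        by (intro measure_slab_le) (auto simp: e_def)
      moreover have "3 * 2 ^ DIM('a) * (?h / P) * V = A * \<rho> * V"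
        using assms by (simp add: P_def A_def power2_eq_square)
      moreover have "{w \<in> cball 0 P. \<bar>w \<bullet> e\<bar> \<le> ?h} \<in> lmeasurable"
      proof -
        have "{w \<in> cball 0 P. \<bar>w \<bullet> e\<bar> \<le> ?h} = cball 0 P \<inter> {w. e \<bullet> w \<le> ?h} \<inter> {w. - ?h \<le> e \<bullet> w}"
          by (auto simp: inner_commute abs_le_iff)
        then show ?thesis
          by (auto intro!: lmeasurable_compact compact_Int_closed closed_halfspace_le closed_halfspace_ge)
      qed
      ultimately show ?thesis by (intro bexI) auto
    qed
    then obtain W where W: "W \<in> lmeasurable" "bad \<subseteq> W" "measure lebesgue W \<le> A * \<rho> * V" by blast
    have G': "uminus ` G u \<in> lmeasurable" "measure lebesgue (uminus ` G u) = measure lebesgue (G u)"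
    proof -
      have "convex (G u)"
        unfolding G_def B_def u(2)
        by (intro convex_Int convex_cball convex_translation convex_interior)
      moreover have "bounded (G u)" unfolding G_def B_def by (intro bounded_Int disjI1 bounded_cball)
      ultimately show "uminus ` G u \<in> lmeasurable"
        by (intro measurable_convex convex_negations bounded_uminus[THEN iffD2]) auto
      show "measure lebesgue (uminus ` G u) = measure lebesgue (G u)"
        using measure_lebesgue_affine[of "-1" "0::'a" "G u"] by simp
    qed
    have "B \<subseteq> G u \<union> uminus ` G u \<union> W"
    proof
      fix w assume w: "w \<in> B"
      show "w \<in> G u \<union> uminus ` G u \<union> W"
      proof (cases "z - w \<in> interior u")
        case True
        then have "- w \<in> G u" using w by (simp add: G_iff B_def)
        then have "w \<in> uminus ` G u" by force
        then show ?thesis by blast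
      next
        case False
        then show ?thesis using w W(2) by (auto simp: G_iff bad_def)
      qed
    qed
    then have "V \<le> measure lebesgue (G u \<union> uminus ` G u \<union> W)"
      unfolding V_def using G[OF \<open>u \<in> F\<close>] G' W B by (intro measure_mono_fmeasurable) auto
    also have "\<dots> \<le> measure lebesgue (G u \<union> uminus ` G u) + measure lebesgue W"
      using G[OF \<open>u \<in> F\<close>] G' W by (intro measure_Un_le) auto
    also have "\<dots> \<le> measure lebesgue (G u) + measure lebesgue (uminus ` G u) + measure lebesgue W"
      using G[OF \<open>u \<in> F\<close>] G' by (intro add_right_mono measure_Un_le) auto
    finally show ?thesis using G'(2) W(3) by (simp add: algebra_simps)
  qed
  have "finite F" using \<open>finite S\<close> by (simp add: F_def)
  have "(\<Sum>u\<in>F. measure lebesgue (G u)) \<le> t * V"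
    unfolding V_def
  proof (rule sum_measure_le_multiplicity[OF \<open>finite F\<close>])
    fix w
    have "card {u\<in>F. w \<in> G u} \<le> card {u\<in>S. z + w \<in> interior u}"
      using \<open>finite S\<close> by (intro card_mono) (auto simp: G_iff F_def)
    then show "card {u\<in>F. w \<in> G u} \<le> t"
      using \<open>thin t S\<close> unfolding thin_def by (meson order_trans)
  qed (use G B in \<open>auto simp: G_def\<close>)
  moreover have "card F * (V * (1 - A * \<rho>)) \<le> (\<Sum>u\<in>F. 2 * measure lebesgue (G u))"
    using sum_mono[OF half, of F] by simp
  ultimately have "V * (card F * (1 - A * \<rho>)) \<le> V * (2 * t)"
    by (simp add: sum_distrib_left[symmetric] mult_ac)
  then show ?thesis using \<open>0 < V\<close> unfolding F_def A_def by simp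
qed

section \<open>Binomial estimates\<close>

lemma binomial_absorb_Suc:
  "real (Suc k) * real ((Suc k + n) choose n) = real (Suc k + n) * real ((k + n) choose n)"
proof -
  have "Suc k * ((Suc k + n) choose n) = (Suc k + n) * ((k + n) choose n)"
    using binomial_absorb_comp[of "Suc k + n" n] by simp
  then show ?thesis by (metis of_nat_mult)
qed

text \<open>Raising \<open>k\<close> by one multiplies the left binomial by
  \<open>(k + 1 + m) / (k + 1)\<close>, which is at most \<open>1 + x\<close> times the
  corresponding factor for \<open>n\<close>.\<close>

lemma binomial_perturb:
  fixes x :: real
  assumes "0 \<le> x" "real m \<le> (1 + x) * real n"
  shows "real ((k + m) choose m) \<le> (1 + x) ^ k * real ((k + n) choose n)"
proof (induction k)
  case (Suc k)
  have "real (Suc k) * real ((Suc k + m) choose m) = real (Suc k + m) * real ((k + m) choose m)"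
    by (rule binomial_absorb_Suc)
  also have "\<dots> \<le> ((1 + x) * real (Suc k + n)) * ((1 + x) ^ k * real ((k + n) choose n))"
  proof (intro mult_mono Suc)
    have "real (Suc k) \<le> (1 + x) * real (Suc k)" using \<open>0 \<le> x\<close> by simp
    then show "real (Suc k + m) \<le> (1 + x) * real (Suc k + n)"
      using assms(2) by (simp add: algebra_simps)
  qed (use \<open>0 \<le> x\<close> in auto)
  also have "\<dots> = (1 + x) ^ Suc k * (real (Suc k + n) * real ((k + n) choose n))" by simp
  also have "real (Suc k + n) * real ((k + n) choose n) = real (Suc k) * real ((Suc k + n) choose n)"
    by (rule binomial_absorb_Suc[symmetric])
  finally have "real (Suc k) * real ((Suc k + m) choose m) \<le>
      real (Suc k) * ((1 + x) ^ Suc k * real ((Suc k + n) choose n))" by (simp add: mult_ac)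
  then show ?case by (subst (asm) mult_le_cancel_left_pos) auto
qed simp

text \<open>The factor \<open>3m + c\<close> comes with the smaller binomial coefficient, which is a fraction
  \<open>k / (k + n)\<close> of the larger one, while the right-hand side gains \<open>(k + n + 1) / (n + 1)\<close>; by AM-GM
  the product of \<open>k / (k + n)\<close> and \<open>(n + 1) / (k + n + 1)\<close> is about \<open>1/4\<close>, which beats the 3.\<close>

lemma refined_bound_le:
  fixes M :: real and t s k m c :: nat
  assumes "1 \<le> M" "20 \<le> k" "15 + 3 * c \<le> m" and s: "real s \<le> 2 * t * (1 + 1 / (20 * k))"
  shows "1 + M * (((k + (s + 1)) choose (s + 1)) + (3 * m + c) * ((k - 1 + (s + 1)) choose (s + 1)))
    \<le> M * m * ((k + 2 * t + 2) choose (2 * t + 2))"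
proof -
  define n where "n = 2 * t + 1"
  define x :: real where "x = 1 / (20 * k)"
  define B B' B'' :: real where "B = (k + n) choose n" and "B' = (k - 1 + n) choose n"
    and "B'' = (k + n + 1) choose (n + 1)"
  have k: "real k \<ge> 20" using assms by simp
  have x: "0 < x" "x < 1" using k by (auto simp: x_def)
  have s': "real (s + 1) \<le> (1 + x) * real n"
  proof -
    have "real s \<le> 2 * t * (1 + x)" using s by (simp add: x_def)
    moreover have "(1 + x) * real n = 2 * t * (1 + x) + (1 + x)" by (simp add: n_def algebra_simps)
    ultimately show ?thesis using x by simp
  qed
  \<comment> \<open>By Bernoulli \<open>(1 - x) ^ k \<ge> 1 - k * x = 19 / 20\<close>, and the
    product of \<open>(1 + x) ^ k\<close> and \<open>(1 - x) ^ k\<close> is at most 1.\<close>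
  have pow: "(1 + x) ^ j \<le> 20 / 19" if "j \<le> k" for j
  proof -
    have "(1 + x) ^ j \<le> (1 + x) ^ k" using x that by (intro power_increasing) auto
    moreover have "(1 + x) ^ k * (19 / 20) \<le> (1 + x) ^ k * (1 - x) ^ k"
    proof (rule mult_left_mono)
      have "1 + real k * (- x) \<le> (1 + - x) ^ k" using x by (intro Bernoulli_inequality) auto
      then show "19 / 20 \<le> (1 - x) ^ k" using k by (simp add: x_def)
    qed (use x in auto)
    moreover have "(1 + x) ^ k * (1 - x) ^ k = (1 - x\<^sup>2) ^ k"
      by (simp add: power_mult_distrib[symmetric] power2_eq_square algebra_simps)
    moreover have "(1 - x\<^sup>2) ^ k \<le> 1" using x by (intro power_le_one) (auto simp: power2_eq_square mult_le_one)
    ultimately show ?thesis by linarith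
  qed
  have s1: "real ((k + (s + 1)) choose (s + 1)) \<le> 20 / 19 * B"
  proof -
    have "real ((k + (s + 1)) choose (s + 1)) \<le> (1 + x) ^ k * B"
      unfolding B_def using x by (intro binomial_perturb s') simp
    also have "\<dots> \<le> 20 / 19 * B" by (intro mult_right_mono pow) (auto simp: B_def)
    finally show ?thesis .
  qed
  have s2: "real ((k - 1 + (s + 1)) choose (s + 1)) \<le> 20 / 19 * B'"
  proof -
    have "real ((k - 1 + (s + 1)) choose (s + 1)) \<le> (1 + x) ^ (k - 1) * B'"
      unfolding B'_def using x by (intro binomial_perturb s') simp
    also have "\<dots> \<le> 20 / 19 * B'" by (intro mult_right_mono pow) (auto simp: B'_def)
    finally show ?thesis .
  qed
  have B'_eq: "real (k + n) * B' = real k * B"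
    using binomial_absorb_Suc[of "k - 1" n] k by (simp add: B_def B'_def)
  have B''_eq: "real (n + 1) * B'' = real (k + n + 1) * B"
  proof -
    have "(n + 1) * ((k + n + 1) choose (n + 1)) = (k + n + 1) * ((k + n) choose n)"
      using Suc_times_binomial[of n "k + n"] by (simp only: Suc_eq_plus1)
    then show ?thesis unfolding B_def B''_def by (metis of_nat_mult)
  qed
  have "1 \<le> (k + n) choose n" using zero_less_binomial[of n "k + n"] by linarith
  then have "1 \<le> B" unfolding B_def by (metis of_nat_1 of_nat_le_iff)
  define Y where "Y = real (k + n + 1) / real (n + 1)"
  have "1 \<le> Y" by (simp add: Y_def)
  have B''_Y: "B'' = Y * B" using B''_eq by (simp add: Y_def field_simps)
  \<comment> \<open>AM-GM gives \<open>1 / 4\<close>; replacing \<open>k + n + 1\<close> by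
    \<open>k + n\<close> costs a factor of at most \<open>21 / 20\<close>, and
    \<open>21 / 80\<close> is below \<open>27 / 100\<close>.\<close>
  have B'_Y: "B' \<le> (27 / 100) * (Y * B)"
  proof -
    have amgm: "4 * (real k * real (n + 1)) \<le> (real (k + n + 1))\<^sup>2"
      using zero_le_power2[of "real k - real (n + 1)"] by (simp add: power2_eq_square algebra_simps)
    have "(real (k + n + 1))\<^sup>2 \<le> real (k + n + 1) * ((21 / 20) * real (k + n))"
      unfolding power2_eq_square using k by (intro mult_left_mono) auto
    also have "\<dots> = (21 / 20) * (real (k + n + 1) * real (k + n))" by simp
    finally have "(real (k + n + 1))\<^sup>2 \<le> (21 / 20) * (real (k + n + 1) * real (k + n))" .
    moreover have "0 \<le> real (k + n + 1) * real (k + n)" by simp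
    ultimately have "real k * real (n + 1) \<le> (27 / 100) * (real (k + n + 1) * real (k + n))"
      using amgm by linarith
    then have "real k / real (k + n) \<le> (27 / 100) * Y"
      using k unfolding Y_def by (simp add: field_simps)
    moreover have "B' = real k / real (k + n) * B" using B'_eq k by (simp add: field_simps)
    ultimately show ?thesis using \<open>1 \<le> B\<close> mult_right_mono[of "real k / real (k + n)" "(27 / 100) * Y" B] by simp
  qed
  have YB: "1 \<le> Y * B" "B \<le> Y * B" using \<open>1 \<le> Y\<close> \<open>1 \<le> B\<close> mult_mono[of 1 Y 1 B] by auto
  \<comment> \<open>\<open>3 * (20 / 19) * (27 / 100)\<close> is below \<open>6 / 7\<close>. The
    remaining \<open>m / 7\<close> is at least \<open>15 / 7 + 3 * c / 7\<close>, which pays for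
    \<open>1 + 20 / 19\<close> and for the term with \<open>c\<close>.\<close>
  have coef: "1 + 20 / 19 + (3 * real m + real c) * (20 / 19 * (27 / 100)) \<le> real m"
  proof -
    have "15 + 3 * real c \<le> real m" using assms(3) by linarith
    then show ?thesis by (simp add: field_simps)
  qed
  have "1 + M * (((k + (s + 1)) choose (s + 1)) + (3 * m + c) * ((k - 1 + (s + 1)) choose (s + 1))) \<le>
      M * (Y * B) + M * (20 / 19 * (Y * B) + (3 * real m + real c) * (20 / 19 * ((27 / 100) * (Y * B))))"
  proof (intro add_mono)
    show "1 \<le> M * (Y * B)" using \<open>1 \<le> M\<close> YB mult_mono[of 1 M 1 "Y * B"] by simp
    have "real ((k + (s + 1)) choose (s + 1)) \<le> 20 / 19 * (Y * B)" using s1 YB by linarith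
    moreover have "real ((k - 1 + (s + 1)) choose (s + 1)) \<le> 20 / 19 * ((27 / 100) * (Y * B))"
      using s2 B'_Y by linarith
    moreover have "M * real (C + (3 * m + c) * C') \<le> M * (a + (3 * real m + real c) * a')"
      if "real C \<le> a" "real C' \<le> a'" for C C' :: nat and a a'
      using that \<open>1 \<le> M\<close> by (auto intro!: mult_left_mono add_mono)
    ultimately show "M * real (((k + (s + 1)) choose (s + 1)) + (3 * m + c) * ((k - 1 + (s + 1)) choose (s + 1)))
      \<le> M * (20 / 19 * (Y * B) + (3 * real m + real c) * (20 / 19 * ((27 / 100) * (Y * B))))"
      by blast
  qed
  also have "\<dots> = M * (Y * B) * (1 + 20 / 19 + (3 * real m + real c) * (20 / 19 * (27 / 100)))"
    by (simp add: algebra_simps)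
  also have "\<dots> \<le> M * (Y * B) * m" using coef \<open>1 \<le> M\<close> YB by (intro mult_left_mono) auto
  also have "\<dots> = M * m * ((k + 2 * t + 2) choose (2 * t + 2))"
    using B''_Y by (simp add: B''_def n_def)
  finally show ?thesis by simp
qed

section \<open>The bound for balls\<close>

lemma wcol_balls:
  "\<exists>k0::nat. \<forall>t (S :: 'a::euclidean_space set set) r k.
     t \<ge> 1 \<longrightarrow> finite S \<longrightarrow> thin t S \<longrightarrow> sizewise S r \<longrightarrow> (\<forall>v\<in>S. is_ball v) \<longrightarrow> k \<ge> k0 \<longrightarrow>
       real (wcol r k (intersection_graph S)) \<le>
         real t * real_of_int (max 1 \<lceil>log 2 (real k)\<rceil>) * (4 * real k - 1) ^ DIM('a) *
         real ((k + 2 * t + 2) choose (2 * t + 2))"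
proof -
  define A :: real where "A = 12 * 2 ^ DIM('a)"
  have A: "A \<ge> 12" by (simp add: A_def)
  \<comment> \<open>The requirement \<open>2 * k \<le> \<rho>\<^sup>2 * 2 ^ q\<close> with
    \<open>\<rho> = 1 / (40 * A * k)\<close> reads
    \<open>3200 * A\<^sup>2 * k ^ 3 \<le> 2 ^ q\<close>. Since \<open>k \<le> 2 ^ m\<close>, the
    choice \<open>q = 3 * m + c\<close> meets it. Both \<open>A\<close> and \<open>c\<close> depend
    on the dimension alone.\<close>
  obtain c where c: "3200 * A\<^sup>2 < 2 ^ c" using real_arch_pow[of 2 "3200 * A\<^sup>2"] by auto
  have "real (wcol r k (intersection_graph S)) \<le>
      real t * real_of_int (max 1 \<lceil>log 2 (real k)\<rceil>) * (4 * real k - 1) ^ DIM('a) *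
      real ((k + 2 * t + 2) choose (2 * t + 2))"
    if "t \<ge> 1" "finite S" "thin t S" "sizewise S r" and balls: "\<forall>v\<in>S. is_ball v"
      and k0: "k \<ge> 2 ^ (15 + 3 * c)" for t and S :: "'a set set" and r and k :: nat
  proof -
    have "(2::nat) ^ 15 \<le> 2 ^ (15 + 3 * c)" by (intro power_increasing) auto
    then have "2 ^ 15 \<le> k" using k0 by (rule order_trans)
    then have k: "20 \<le> k" "1 \<le> k" "0 < real k" by auto
    obtain m :: nat where m: "real_of_int (max 1 \<lceil>log 2 (real k)\<rceil>) = m" "1 \<le> m" "k \<le> 2 ^ m"
      using le_two_power_ceiling_log[OF \<open>1 \<le> k\<close>] .
    have "(2::nat) ^ (15 + 3 * c) \<le> 2 ^ m" using k0 m(3) by (rule order_trans)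
    \<comment> \<open>The threshold on \<open>k\<close> was chosen for this inequality, which lets
      \<open>m\<close> absorb the constants in \<open>refined_bound_le\<close>.\<close>
    then have m_ge: "15 + 3 * c \<le> m" by (rule power_le_imp_le_exp[rotated]) simp
    define q where "q = 3 * m + c"
    \<comment> \<open>This makes the relative slab loss \<open>A * \<rho>\<close> equal to
      \<open>1 / (40 * k)\<close>, small enough that raising \<open>1 + 1 / (20 * k)\<close> to the
      power \<open>k\<close> costs only a constant factor.\<close>
    define \<rho> where "\<rho> = 1 / (40 * A * k)"
    define s where "s = nat \<lfloor>2 * t * (1 + 1 / (20 * k)) :: real\<rfloor>"
    define M where "M = real t * 1 * (4 * real k - 2 + 1) ^ DIM('a)"
    have s: "real s \<le> 2 * t * (1 + 1 / (20 * k))"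
      unfolding s_def by (rule of_nat_floor) simp
    have "1 \<le> M"
    proof -
      have "1 * 1 \<le> real t * (4 * real k - 2 + 1) ^ DIM('a)"
        using \<open>t \<ge> 1\<close> k by (intro mult_mono one_le_power) auto
      then show ?thesis by (simp add: M_def)
    qed
    have "ball_like 1 v" if "v \<in> S" for v :: "'a set"
    proof -
      obtain x \<rho> where v: "0 < \<rho>" "v = cball x \<rho>" using balls \<open>v \<in> S\<close> unfolding is_ball_def by blast
      interpret symmetric_body "cball (0::'a) 1" by (rule symmetric_body_cball)
      have "measure lebesgue ((+) x ` cball 0 \<rho>) = measure lebesgue (cball (0::'a) \<rho>)"
        by (rule measure_translation)
      then show ?thesis using v by (simp add: ball_like_def)
    qed
    then interpret object_system "cball 0 1" S t 1 "\<lambda>v. diameter v / 2"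
      using that by (intro object_system_ball_like) auto
    have far: "card {x\<in>S. 2 ^ q * R \<le> diameter x / 2 \<and> (\<exists>p\<in>x. p - z \<in> D (2 * real k * R))} \<le> s"
      if "0 < R" for R z
    proof -
      define R' where "R' = 2 ^ q * R"
      have "0 < R'" using \<open>0 < R\<close> by (simp add: R'_def)
      have A\<rho>: "A * \<rho> = 1 / (40 * k)" using A by (simp add: \<rho>_def)
      have \<rho>: "0 < \<rho>" "\<rho> \<le> 1 / 2"
      proof -
        have "1 * 1 \<le> A * real k" using A k by (intro mult_mono) auto
        then show "0 < \<rho>" "\<rho> \<le> 1 / 2" unfolding \<rho>_def by (auto simp: field_simps)
      qed
      have "2 * real k \<le> \<rho>\<^sup>2 * 2 ^ q"
      proof -
        have "real k ^ 3 * (3200 * A\<^sup>2) \<le> (2 ^ m) ^ 3 * 2 ^ c"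
        proof (intro mult_mono power_mono)
          show "real k \<le> 2 ^ m" using m(3) by (metis of_nat_le_iff of_nat_numeral of_nat_power)
        qed (use c in auto)
        also have "\<dots> = 2 ^ q" by (simp add: q_def power_add mult.commute flip: power_mult)
        finally have "\<rho>\<^sup>2 * (real k ^ 3 * (3200 * A\<^sup>2)) \<le> \<rho>\<^sup>2 * 2 ^ q" by (intro mult_left_mono) auto
        moreover have "\<rho>\<^sup>2 * (real k ^ 3 * (3200 * A\<^sup>2)) = 2 * real k"
          using A k by (simp add: \<rho>_def power2_eq_square power3_eq_cube field_simps)
        ultimately show ?thesis by simp
      qed
      then have "2 * real k * R \<le> \<rho>\<^sup>2 * R'"
        using \<open>0 < R\<close> mult_right_mono[of "2 * real k" "\<rho>\<^sup>2 * 2 ^ q" R] by (simp add: R'_def)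
      then have near: "dist z p \<le> \<rho>\<^sup>2 * R'" if "p - z \<in> D (2 * real k * R)" for p
        using that \<open>0 < R\<close> by (simp add: D_cball dist_norm norm_minus_commute)
      define N where "N = card {x\<in>S. R' \<le> diameter x / 2 \<and> (\<exists>p\<in>x. dist z p \<le> \<rho>\<^sup>2 * R')}"
      have "card {x\<in>S. 2 ^ q * R \<le> diameter x / 2 \<and> (\<exists>p\<in>x. p - z \<in> D (2 * real k * R))} \<le> N"
        unfolding N_def R'_def[symmetric] using near finite_objects by (intro card_mono) auto
      also have "N \<le> s"
      proof -
        define y :: real where "y = 1 / (40 * k)"
        have y: "0 < y" "y \<le> 1 / 2" using k by (auto simp: y_def)
        have "N * (1 - y) \<le> 2 * t"
          using card_large_balls_le[OF finite_objects thin balls \<open>0 < R'\<close> \<rho>, of z] A\<rho>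
          unfolding N_def A_def y_def by simp
        then have "N * (1 - y) * (1 + 2 * y) \<le> 2 * t * (1 + 2 * y)"
          using y by (intro mult_right_mono) auto
        \<comment> \<open>Since \<open>(1 - y) * (1 + 2 * y) \<ge> 1\<close> for \<open>y\<close>
          between 0 and \<open>1 / 2\<close>, the factor \<open>1 - y\<close> can be traded for
          \<open>1 + 2 * y\<close> on the other side.\<close>
        moreover have "real N * 1 \<le> N * ((1 - y) * (1 + 2 * y))"
        proof (rule mult_left_mono)
          have "0 \<le> y * (1 - 2 * y)" using y by (intro mult_nonneg_nonneg) auto
          then show "1 \<le> (1 - y) * (1 + 2 * y)" by (simp add: algebra_simps)
        qed simp
        ultimately have "real N \<le> 2 * t * (1 + 1 / (20 * k))" by (simp add: y_def mult.assoc)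
        then show ?thesis unfolding s_def by linarith
      qed
      finally show ?thesis .
    qed
    have order: "diameter w / 2 \<le> diameter u / 2"
      if "u \<in> S" "w \<in> S" "(u, w) \<in> r" "u \<noteq> w" for u w
      using sizewise_diameter[OF \<open>sizewise S r\<close> that] by simp
    have "real (wcol r k (intersection_graph S)) \<le> M * m * ((k + 2 * t + 2) choose (2 * t + 2))"
    proof (rule wcol_le[OF finite_objects])
      fix v assume "v \<in> S"
      obtain z \<rho> where v: "0 < \<rho>" "v = cball z \<rho>" using balls \<open>v \<in> S\<close> unfolding is_ball_def by blast
      have z: "x - z \<in> D (1 * (diameter v / 2))" if "x \<in> v" for x
        using that v by (simp add: D_cball dist_norm norm_minus_commute)
      have "real (card (wreach r k (intersection_graph S) v)) \<le>
          1 + M * (((k + (s + 1)) choose (s + 1)) + q * ((k - 1 + (s + 1)) choose (s + 1)))"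
        unfolding M_def
        by (rule card_wreach_le_refined[OF \<open>v \<in> S\<close> \<open>1 \<le> k\<close> _ _ _ z order far])
           (use m(2) in \<open>auto simp: q_def\<close>)
      also have "\<dots> \<le> M * m * ((k + 2 * t + 2) choose (2 * t + 2))"
        unfolding q_def by (rule refined_bound_le[OF \<open>1 \<le> M\<close> k(1) m_ge s])
      finally show "real (card (wreach r k (intersection_graph S) v)) \<le>
          M * m * ((k + 2 * t + 2) choose (2 * t + 2))" .
    qed (use \<open>1 \<le> M\<close> in auto)
    then show ?thesis unfolding m(1) M_def by (simp add: mult_ac)
  qed
  then show ?thesis by blast
qed

theorem theorem3:
  shows "(\<forall>(t::nat) (S :: (real ^ 'n::finite) set set) r (k::nat).
            t \<ge> 1 \<longrightarrow> finite S \<longrightarrow> (\<forall>v\<in>S. compact v \<and> convex v \<and> v \<noteq> {}) \<longrightarrow>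
            thin t S \<longrightarrow> sizewise S r \<longrightarrow> k \<ge> 1 \<longrightarrow>
            ((\<exists>K. compact K \<and> convex K \<and> interior K \<noteq> {} \<and> centrally_symmetric K \<and>
                  (\<forall>v\<in>S. scaled_translate K v)) \<longrightarrow>
               real (wcol r k (intersection_graph S)) \<le>
                 real t * real_of_int (max 1 \<lceil>log 2 (real k)\<rceil>) * (4 * real k - 1) ^ CARD('n) *
                 real ((k + t * 5 ^ CARD('n) + 2) choose (t * 5 ^ CARD('n) + 2))) \<and>
            (\<forall>b::real. b \<ge> 1 \<longrightarrow> (\<forall>v\<in>S. ball_like b v) \<longrightarrow>
               real (wcol r k (intersection_graph S)) \<le>
                 real t * b * real_of_int (max 1 \<lceil>log 2 (real k)\<rceil>) * (4 * real k) ^ CARD('n) *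
                 real_binomial (real k + real t * b * 6 ^ CARD('n) + 2)
                               (real t * b * 6 ^ CARD('n) + 2)))
       \<and> (\<exists>k0::nat. \<forall>(t::nat) (S :: (real ^ 'n) set set) r (k::nat).
            t \<ge> 1 \<longrightarrow> finite S \<longrightarrow> thin t S \<longrightarrow> sizewise S r \<longrightarrow> (\<forall>v\<in>S. is_ball v) \<longrightarrow> k \<ge> k0 \<longrightarrow>
               real (wcol r k (intersection_graph S)) \<le>
                 real t * real_of_int (max 1 \<lceil>log 2 (real k)\<rceil>) * (4 * real k - 1) ^ CARD('n) *
                 real ((k + 2 * t + 2) choose (2 * t + 2)))"
proof (intro conjI allI impI)
  fix t :: nat and S :: "(real ^ 'n) set set" and r and k :: nat
  assume *: "t \<ge> 1" "finite S" "\<forall>v\<in>S. compact v \<and> convex v \<and> v \<noteq> {}" "thin t S" "sizewise S r"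
    "k \<ge> 1"
  { assume "\<exists>K. compact K \<and> convex K \<and> interior K \<noteq> {} \<and> centrally_symmetric K \<and>
      (\<forall>v\<in>S. scaled_translate K v)"
    then show "real (wcol r k (intersection_graph S)) \<le>
        real t * real_of_int (max 1 \<lceil>log 2 (real k)\<rceil>) * (4 * real k - 1) ^ CARD('n) *
        real ((k + t * 5 ^ CARD('n) + 2) choose (t * 5 ^ CARD('n) + 2))"
      using wcol_homothets[OF *(1,2,4,5,6)] by auto }
  { fix b :: real
    assume "b \<ge> 1" "\<forall>v\<in>S. ball_like b v"
    then show "real (wcol r k (intersection_graph S)) \<le>
        real t * b * real_of_int (max 1 \<lceil>log 2 (real k)\<rceil>) * (4 * real k) ^ CARD('n) *
        real_binomial (real k + real t * b * 6 ^ CARD('n) + 2) (real t * b * 6 ^ CARD('n) + 2)"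
      using wcol_ball_like[OF *(1,2,4,5,6)] *(3) by auto }
qed (use wcol_balls[where 'a = "real ^ 'n"] in simp)

end
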